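(* Let $H,K$ be $6\times6$ complex Hermitian matrices and let $F(x,y,z)$ be a homogeneous polynomial defining a smooth cubic curve in $\mathbb{CP}^2$, such that $$\det(xH+yK-z\,\mathrm{Id})=F(x,y,z)^2 .$$ Then $H$ and $K$ are simultaneously unitarily similar to direct sums: there exist a unitary $6\times 6$ matrix $U$ and matrices $H_1,H_2,K_1,K_2\in \mathrm{M}_3(\mathbb{C})$ such that $$UHU^{*}=\begin{bmatrix}H_1&0\\0&H_2\end{bmatrix}\quad\text{and}\quad UKU^{*}=\begin{bmatrix}K_1&0\\0&K_2\end{bmatrix}.$$
   Context: $\mathrm{M}_n(\mathbb{C})$ denotes the algebra of $n\times n$ complex matrices, $\mathrm{Id}$ the $6\times6$ identity matrix, and $U^{*}$ the conjugate transpose of $U$. *)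

theory Defs
  imports
    "Jordan_Normal_Form.Schur_Decomposition"
    "HOL-Library.Poly_Mapping"
    "HOL-Library.Product_Plus"
begin

(* The polynomial ring C[x,y,z] as the monoid algebra of N^3:
   the key (i,j,k) stands for the monomial x^i y^j z^k. *)
type_synonym poly3 = "(nat \<times> nat \<times> nat) \<Rightarrow>\<^sub>0 complex"

definition eval3 :: "poly3 \<Rightarrow> complex \<Rightarrow> complex \<Rightarrow> complex \<Rightarrow> complex" where
  "eval3 F x y z =
     (\<Sum>(i, j, k)\<in>Poly_Mapping.keys F. Poly_Mapping.lookup F (i, j, k) * x ^ i * y ^ j * z ^ k)"

definition homogeneous3 :: "nat \<Rightarrow> poly3 \<Rightarrow> bool" where
  "homogeneous3 d F \<longleftrightarrow> (\<forall>(i, j, k)\<in>Poly_Mapping.keys F. i + j + k = d)"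

(* Formal partial derivatives. The truncated exponent 0 - 1 only occurs with coefficient 0. *)
definition partial_x :: "poly3 \<Rightarrow> poly3" where
  "partial_x F = (\<Sum>(i, j, k)\<in>Poly_Mapping.keys F.
     Poly_Mapping.single (i - 1, j, k) (of_nat i * Poly_Mapping.lookup F (i, j, k)))"

definition partial_y :: "poly3 \<Rightarrow> poly3" where
  "partial_y F = (\<Sum>(i, j, k)\<in>Poly_Mapping.keys F.
     Poly_Mapping.single (i, j - 1, k) (of_nat j * Poly_Mapping.lookup F (i, j, k)))"

definition partial_z :: "poly3 \<Rightarrow> poly3" where
  "partial_z F = (\<Sum>(i, j, k)\<in>Poly_Mapping.keys F.
     Poly_Mapping.single (i, j, k - 1) (of_nat k * Poly_Mapping.lookup F (i, j, k)))"

(* F defines a smooth curve of degree d in CP^2: F is homogeneous of degree d and the gradient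
   vanishes at no point of the curve. Points of CP^2 are given by homogeneous coordinates,
   that is, by triples (x,y,z) different from (0,0,0). *)
definition smooth_plane_curve :: "nat \<Rightarrow> poly3 \<Rightarrow> bool" where
  "smooth_plane_curve d F \<longleftrightarrow> homogeneous3 d F \<and>
     (\<forall>x y z. (x, y, z) \<noteq> (0, 0, 0) \<and> eval3 F x y z = 0 \<longrightarrow>
        eval3 (partial_x F) x y z \<noteq> 0 \<or>
        eval3 (partial_y F) x y z \<noteq> 0 \<or>
        eval3 (partial_z F) x y z \<noteq> 0)"

(* mat_adjoint is the conjugate transpose. *)
definition hermitian_mat :: "complex mat \<Rightarrow> bool" where
  "hermitian_mat A \<longleftrightarrow> square_mat A \<and> mat_adjoint A = A"

definition unitary_mat :: "complex mat \<Rightarrow> bool" where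
  "unitary_mat U \<longleftrightarrow> square_mat U \<and>
     U * mat_adjoint U = 1\<^sub>m (dim_row U) \<and> mat_adjoint U * U = 1\<^sub>m (dim_row U)"

definition direct_sum_mat :: "complex mat \<Rightarrow> complex mat \<Rightarrow> complex mat" where
  "direct_sum_mat A B =
     four_block_mat A (0\<^sub>m (dim_row A) (dim_col B)) (0\<^sub>m (dim_row B) (dim_col A)) B"

end

theory Submission
  imports Defs
begin

text \<open>
  Write \<open>F\<^sup>2 = G\<^sup>2\<close> with \<open>G\<close> monic in \<open>z\<close>. For real \<open>x, y\<close> the matrix \<open>x H + y K\<close> is Hermitian and its eigenvalues are roots of
  \<open>G (x, y, _)\<close>, so \<open>G (x, y, x H + y K) = 0\<close>. A double root of the real-rooted cubic \<open>G (1, 0, _)\<close>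
  would give a singular point, so \<open>H\<close> has three distinct eigenvalues, each of multiplicity two, with spectral projections
  \<open>P, Q, R\<close>. Read blockwise, the matrix identity makes the diagonal blocks of \<open>K\<close> scalar and forces
  \<open>\<alpha> = P K Q K P\<close> and \<open>\<gamma> = P K Q K R K P\<close> to satisfy \<open>\<gamma> \<alpha> - \<alpha> \<gamma> = f (\<alpha>)\<close> for a polynomial \<open>f\<close>. Since \<open>\<alpha>\<close> is Hermitian,
  \<open>f (\<alpha>)\<close> vanishes, and \<open>\<alpha>\<close>, \<open>\<gamma>\<close> and the adjoint of \<open>\<gamma>\<close> have a common eigenvector \<open>u\<close> in the range of \<open>P\<close>.
  All compressions to the range of \<open>P\<close> of words in \<open>H\<close> and \<open>K\<close> are generated by these three, so \<open>u\<close> generates a proper reducing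
  subspace. If it, or its complement, had dimension one or two, then \<open>G\<close> would have a linear factor, and the
  curve would be singular on that line.
\<close>

section \<open>Noncommutative relations of a cubic pencil\<close>

lemma scaleR_eq_imp_multiple:
  fixes x y :: "'a::real_vector"
  assumes "c *\<^sub>R x = d *\<^sub>R y" "c \<noteq> 0"
  shows "x = (d / c) *\<^sub>R y"
  by (metis assms divide_inverse mult.commute scaleR_scaleR scaleR_one left_inverse)

text \<open>
  \<open>R1\<close>, \<open>R2\<close> and \<open>R3\<close> are the coefficients of \<open>x\<^sup>2 y\<close>, \<open>x y\<^sup>2\<close> and \<open>y\<^sup>3\<close> in \<open>g (x, y, x X + y Y) = 0\<close>
  for a ternary cubic \<open>g\<close>, monic in the third variable, with \<open>g (1, 0, z) = (z - p) (z - q) (z - r)\<close>.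
\<close>

locale cubic_pencil =
  fixes X Y P Q R :: "'a::real_algebra_1" and p q r b1 b2 b3 c2 c3 d3 :: real
  assumes idem: "P * P = P" "Q * Q = Q" "R * R = R" "P * Q = 0" "P * R = 0" "Q * P = 0" "Q * R = 0"
      "R * P = 0" "R * Q = 0"
    and one: "P + Q + R = 1"
    and X: "X = p *\<^sub>R P + q *\<^sub>R Q + r *\<^sub>R R"
    and ne: "p \<noteq> q" "p \<noteq> r" "q \<noteq> r"
    and R1: "X * X * Y + X * Y * X + Y * X * X - (p + q + r) *\<^sub>R (X * Y + Y * X) + b1 *\<^sub>R (X * X)
        + (p * q + p * r + q * r) *\<^sub>R Y + b2 *\<^sub>R X + b3 *\<^sub>R 1 = 0"
    and R2: "X * Y * Y + Y * X * Y + Y * Y * X - (p + q + r) *\<^sub>R (Y * Y) + b1 *\<^sub>R (X * Y + Y * X)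
        + b2 *\<^sub>R Y + c2 *\<^sub>R X + c3 *\<^sub>R 1 = 0"
    and R3: "Y * Y * Y + b1 *\<^sub>R (Y * Y) + c2 *\<^sub>R Y + d3 *\<^sub>R 1 = 0"
begin

lemma XP: "X * P = p *\<^sub>R P" and PX: "P * X = p *\<^sub>R P"
  by (simp_all add: X idem algebra_simps)

lemma PX': "P * (X * z) = p *\<^sub>R (P * z)"
  using PX by (simp add: mult.assoc[symmetric])

lemma idem': "P * (P * z) = P * z" "Q * (Q * z) = Q * z" "R * (R * z) = R * z"
  "P * (Q * z) = 0" "P * (R * z) = 0" "Q * (P * z) = 0" "Q * (R * z) = 0" "R * (P * z) = 0" "R * (Q * z) = 0"
  by (simp_all add: mult.assoc[symmetric] idem)

text \<open>Inserting \<open>P + Q + R = 1\<close> between two factors turns a word into the sum of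
  its paths through the three eigenspaces; the compressions below are expanded in this way.\<close>

lemma mult_split: "a * b = a * (P * b) + a * (Q * b) + a * (R * b)"
proof -
  have "a * b = a * ((P + Q + R) * b)" using one by simp
  then show ?thesis by (simp add: algebra_simps)
qed

text \<open>Compress \<open>R1\<close> by \<open>P\<close> on both sides: every \<open>X\<close>
  becomes \<open>p\<close>, and the coefficient left on \<open>P * Y * P\<close> is the derivative
  of \<open>(z - p) (z - q) (z - r)\<close> at \<open>p\<close>, which is nonzero. All other terms
  are multiples of \<open>P\<close>.\<close>

lemma diagonal_block: "\<exists>m. P * Y * P = m *\<^sub>R P"
proof -
  have "0 = P * (X * X * Y + X * Y * X + Y * X * X - (p + q + r) *\<^sub>R (X * Y + Y * X) + b1 *\<^sub>R (X * X)
        + (p * q + p * r + q * r) *\<^sub>R Y + b2 *\<^sub>R X + b3 *\<^sub>R 1) * P"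
    by (simp only: R1) simp
  also have "\<dots> = ((p - q) * (p - r)) *\<^sub>R (P * Y * P) + (b1 * p * p + b2 * p + b3) *\<^sub>R P"
    by (simp add: XP PX' PX idem algebra_simps)
  finally have "((p - q) * (p - r)) *\<^sub>R (P * Y * P) = (- (b1 * p * p + b2 * p + b3)) *\<^sub>R P"
    by (simp only: scaleR_minus_left eq_neg_iff_add_eq_0)
  from scaleR_eq_imp_multiple[OF this] ne show ?thesis by auto
qed

text \<open>Compress \<open>R2\<close> by \<open>P\<close>. The loops through \<open>Q\<close> and
  \<open>R\<close> receive the coefficients \<open>2 p + q - (p + q + r)\<close> and
  \<open>2 p + r - (p + q + r)\<close>. Both are nonzero, so either loop can be eliminated in favour
  of the other.\<close>

lemma quadratic_loop: "\<exists>s. (p - r) *\<^sub>R (P * Y * Q * Y * P) + (p - q) *\<^sub>R (P * Y * R * Y * P) = s *\<^sub>R P"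
proof -
  obtain m where m: "P * Y * P = m *\<^sub>R P" using diagonal_block by auto
  have m': "P * (Y * (P * z)) = m *\<^sub>R (P * z)" for z
    using m by (metis mult.assoc mult_scaleR_left)
  define a where "a = P * (Y * (Q * (Y * P)))"
  define b where "b = P * (Y * (R * (Y * P)))"
  have 1: "P * (Y * (Y * P)) = (m * m) *\<^sub>R P + a + b"
    using m m' by (subst mult_split) (simp add: a_def b_def idem algebra_simps)
  have 2: "P * (Y * (X * (Y * P))) = (p * m * m) *\<^sub>R P + q *\<^sub>R a + r *\<^sub>R b"
    using m m' by (simp add: a_def b_def idem X algebra_simps)
  have "0 = P * (X * Y * Y + Y * X * Y + Y * Y * X - (p + q + r) *\<^sub>R (Y * Y) + b1 *\<^sub>R (X * Y + Y * X)
        + b2 *\<^sub>R Y + c2 *\<^sub>R X + c3 *\<^sub>R 1) * P"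
    by (simp only: R2) simp
  also have "\<dots> = (p - r) *\<^sub>R a + (p - q) *\<^sub>R b
      + (m * (m * p)) *\<^sub>R P + (b1 * (m * p)) *\<^sub>R P
      + ((p - q - r) * m * m + b1 * m * p + b2 * m + c2 * p + c3) *\<^sub>R P"
    using m by (simp add: XP PX' PX idem 1 2 algebra_simps)
  finally have "(p - r) *\<^sub>R a + (p - q) *\<^sub>R b =
       (- (m * (m * p) + b1 * (m * p) + ((p - q - r) * m * m + b1 * m * p + b2 * m + c2 * p + c3))) *\<^sub>R P"
    by (simp only: scaleR_minus_left eq_neg_iff_add_eq_0 scaleR_add_left add.assoc)
  then show ?thesis unfolding a_def b_def mult.assoc by blast
qed

end

text \<open>The hypotheses are symmetric in the three eigenvalues, so each fact about loops based at
  \<open>P\<close> also holds at \<open>Q\<close> and at \<open>R\<close>.\<close>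

lemma cubic_pencil_permute:
  assumes "cubic_pencil X Y P Q R p q r b1 b2 b3 c2 c3 d3"
  shows "cubic_pencil X Y Q P R q p r b1 b2 b3 c2 c3 d3"
    "cubic_pencil X Y R Q P r q p b1 b2 b3 c2 c3 d3"
proof -
  interpret cubic_pencil X Y P Q R p q r b1 b2 b3 c2 c3 d3 by fact
  show "cubic_pencil X Y Q P R q p r b1 b2 b3 c2 c3 d3"
    "cubic_pencil X Y R Q P r q p b1 b2 b3 c2 c3 d3"
    using idem one ne X R1 R2 R3 by (unfold_locales; (simp add: ac_simps))+
qed

context cubic_pencil
begin

text \<open>Compress \<open>R3\<close> by \<open>P\<close>. Among the paths of length three from
  \<open>P\<close> to \<open>P\<close>, those that stay in place at some step shorten by
  \<open>diagonal_block\<close>; the only others are the circuit through \<open>Q\<close> and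
  \<open>R\<close> and its reverse.\<close>

lemma cubic_loop: "\<exists>k c. P * Y * Q * Y * R * Y * P + P * Y * R * Y * Q * Y * P = k *\<^sub>R (P * Y * Q * Y * P) + c *\<^sub>R P"
proof -
  obtain m where m: "P * Y * P = m *\<^sub>R P" using diagonal_block by auto
  interpret Q: cubic_pencil X Y Q P R q p r b1 b2 b3 c2 c3 d3
    using cubic_pencil_axioms by (rule cubic_pencil_permute)
  interpret R: cubic_pencil X Y R Q P r q p b1 b2 b3 c2 c3 d3
    using cubic_pencil_axioms by (rule cubic_pencil_permute)
  obtain mq where mq: "Q * Y * Q = mq *\<^sub>R Q" using Q.diagonal_block by auto
  obtain mr where mr: "R * Y * R = mr *\<^sub>R R" using R.diagonal_block by auto
  have m': "P * (Y * (P * z)) = m *\<^sub>R (P * z)" "Q * (Y * (Q * z)) = mq *\<^sub>R (Q * z)" 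
    "R * (Y * (R * z)) = mr *\<^sub>R (R * z)" for z
    using m mq mr by (metis mult.assoc mult_scaleR_left)+
  define a where "a = P * (Y * (Q * (Y * P)))"
  define b where "b = P * (Y * (R * (Y * P)))"
  define g where "g = P * (Y * (Q * (Y * (R * (Y * P)))))"
  define h where "h = P * (Y * (R * (Y * (Q * (Y * P)))))"
  have 1: "P * (Y * (Y * P)) = (m * m) *\<^sub>R P + a + b"
    using m m' by (subst mult_split) (simp add: a_def b_def idem algebra_simps)
  have "P * (Y * (Y * (Y * P))) = P * (Y * ((P + Q + R) * (Y * ((P + Q + R) * (Y * P)))))"
    by (simp add: one)
  also have "\<dots> = (m * m * m) *\<^sub>R P + m *\<^sub>R a + (m + mq) *\<^sub>R a + m *\<^sub>R b + (m + mr) *\<^sub>R b + g + h"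
    using m by (simp add: a_def b_def g_def h_def idem m' algebra_simps)
  finally have 2: "P * (Y * (Y * (Y * P))) = (m * m * m) *\<^sub>R P + m *\<^sub>R a + (m + mq) *\<^sub>R a + m *\<^sub>R b + (m + mr) *\<^sub>R b + g + h" .
  have "0 = P * (Y * Y * Y + b1 *\<^sub>R (Y * Y) + c2 *\<^sub>R Y + d3 *\<^sub>R 1) * P"
    by (simp only: R3) simp
  also have "\<dots> = g + h + (m *\<^sub>R a + (m + mq + b1) *\<^sub>R a) + (m *\<^sub>R b + (m + mr + b1) *\<^sub>R b)
      + (m * m * m + b1 * m * m + c2 * m + d3) *\<^sub>R P"
    using m by (simp add: idem 1 2 algebra_simps)
  also have "\<dots> = g + h + (m + m + mq + b1) *\<^sub>R a + (m + m + mr + b1) *\<^sub>R b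
      + (m * m * m + b1 * m * m + c2 * m + d3) *\<^sub>R P"
    by (simp only: scaleR_add_left add.assoc)
  finally have 3: "g + h = - (m + m + mq + b1) *\<^sub>R a - (m + m + mr + b1) *\<^sub>R b
      - (m * m * m + b1 * m * m + c2 * m + d3) *\<^sub>R P"
    by (simp add: algebra_simps eq_neg_iff_add_eq_0)
  obtain s where "(p - r) *\<^sub>R a + (p - q) *\<^sub>R b = s *\<^sub>R P"
    using quadratic_loop unfolding a_def b_def mult.assoc by blast
  \<comment> \<open>The loop \<open>b\<close> through \<open>R\<close> is traded for
    \<open>a\<close> and \<open>P\<close>, so a single quadratic loop remains in the
    statement.\<close>
  then have "(p - q) *\<^sub>R b = 1 *\<^sub>R (s *\<^sub>R P - (p - r) *\<^sub>R a)" by (simp add: algebra_simps)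
  from scaleR_eq_imp_multiple[OF this] ne
  obtain e f where b: "b = e *\<^sub>R P - f *\<^sub>R a" by (auto simp: scaleR_diff_right)
  obtain A B C where gh: "g + h = A *\<^sub>R a + B *\<^sub>R b + C *\<^sub>R P"
    using 3 by (metis diff_conv_add_uminus scaleR_minus_left)
  have "g + h = (A - B * f) *\<^sub>R a + (B * e + C) *\<^sub>R P"
    unfolding gh b by (simp add: algebra_simps)
  then show ?thesis unfolding a_def g_def h_def mult.assoc by blast
qed

text \<open>
  The product \<open>\<gamma> \<alpha>\<close> is the loop \<open>Q Y R Y P Y Q\<close>, based at \<open>Q\<close>, conjugated to one based at \<open>P\<close>; so \<open>cubic_loop\<close>
  at \<open>Q\<close> turns \<open>\<gamma> \<alpha>\<close> into \<open>- \<alpha> \<gamma>'\<close> modulo polynomials in \<open>\<alpha>\<close>, and \<open>cubic_loop\<close> at \<open>P\<close> turns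
  \<open>- \<alpha> \<gamma>'\<close> into \<open>\<alpha> \<gamma>\<close>.
\<close>

lemma loop_commutator:
  defines "\<alpha> \<equiv> P * Y * Q * Y * P" and "\<gamma> \<equiv> P * Y * Q * Y * R * Y * P"
  shows "\<exists>k c. \<gamma> * \<alpha> - \<alpha> * \<gamma> = k *\<^sub>R (\<alpha> * \<alpha>) + c *\<^sub>R \<alpha>"
proof -
  interpret Q: cubic_pencil X Y Q P R q p r b1 b2 b3 c2 c3 d3
    using cubic_pencil_axioms by (rule cubic_pencil_permute)
  define \<gamma>' where "\<gamma>' = P * Y * R * Y * Q * Y * P"
  obtain k c where 1: "\<gamma> + \<gamma>' = k *\<^sub>R \<alpha> + c *\<^sub>R P"
    using cubic_loop unfolding \<alpha>_def \<gamma>_def \<gamma>'_def by blast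
  obtain k' c' where 2: "Q * Y * P * Y * R * Y * Q + Q * Y * R * Y * P * Y * Q = k' *\<^sub>R (Q * Y * P * Y * Q) + c' *\<^sub>R Q"
    using Q.cubic_loop by blast
  have 3: "\<alpha> * \<gamma> + \<alpha> * \<gamma>' = k *\<^sub>R (\<alpha> * \<alpha>) + c *\<^sub>R \<alpha>"
  proof -
    have "\<alpha> * \<gamma> + \<alpha> * \<gamma>' = \<alpha> * (k *\<^sub>R \<alpha> + c *\<^sub>R P)" by (simp only: 1[symmetric] distrib_left)
    moreover have "\<alpha> * P = \<alpha>" by (simp add: \<alpha>_def mult.assoc idem)
    ultimately show ?thesis by (simp add: algebra_simps)
  qed
  have "\<alpha> * \<gamma>' + \<gamma> * \<alpha> = P * Y * (Q * Y * P * Y * R * Y * Q + Q * Y * R * Y * P * Y * Q) * Y * P"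
    by (simp add: \<alpha>_def \<gamma>_def \<gamma>'_def idem idem' distrib_left distrib_right mult.assoc)
  also have "\<dots> = k' *\<^sub>R (\<alpha> * \<alpha>) + c' *\<^sub>R \<alpha>"
    unfolding 2 by (simp add: \<alpha>_def idem' distrib_left distrib_right mult.assoc)
  finally have "\<gamma> * \<alpha> - \<alpha> * \<gamma> = (k' - k) *\<^sub>R (\<alpha> * \<alpha>) + (c' - c) *\<^sub>R \<alpha>"
    using 3 by (simp add: algebra_simps) (metis add.assoc add.commute add_right_cancel)
  then show ?thesis by blast
qed

end

section \<open>Unitary diagonalization of Hermitian matrices\<close>

lemma mat_adjoint_carrier [simp]: "A \<in> carrier_mat n m \<Longrightarrow> mat_adjoint A \<in> carrier_mat m n"
  by (auto simp: mat_adjoint_def)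

lemma mat_adjoint_dim [simp]: "dim_row (mat_adjoint A) = dim_col A" "dim_col (mat_adjoint A) = dim_row A"
  by (auto simp: mat_adjoint_def)

lemma mat_adjoint_index [simp]:
  fixes A :: "complex mat"
  shows "i < dim_col A \<Longrightarrow> j < dim_row A \<Longrightarrow> mat_adjoint A $$ (i, j) = cnj (A $$ (j, i))"
  by (simp add: mat_adjoint_def mat_of_rows_index)

lemma mat_adjoint_adjoint [simp]: "mat_adjoint (mat_adjoint A) = (A :: complex mat)"
  by (rule eq_matI) auto

lemma mat_adjoint_mult:
  fixes A B :: "complex mat"
  assumes "A \<in> carrier_mat n m" "B \<in> carrier_mat m k"
  shows "mat_adjoint (A * B) = mat_adjoint B * mat_adjoint A"
proof (rule eq_matI)
  fix i j assume "i < dim_row (mat_adjoint B * mat_adjoint A)" "j < dim_col (mat_adjoint B * mat_adjoint A)"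
  with assms show "mat_adjoint (A * B) $$ (i, j) = (mat_adjoint B * mat_adjoint A) $$ (i, j)"
    by (auto simp: scalar_prod_def mult.commute intro!: sum.cong)
qed (use assms in auto)

text \<open>Gram-Schmidt keeps the first vector of a basis that starts with \<open>v\<close> and
  yields orthogonal, not normalised, vectors; dividing by their norms gives the columns of
  \<open>W\<close>.\<close>

lemma unitary_completion:
  fixes v :: "complex vec"
  assumes v: "v \<in> carrier_vec n" "v \<noteq> 0\<^sub>v n"
  shows "\<exists>W\<in>carrier_mat n n. \<exists>c. mat_adjoint W * W = 1\<^sub>m n \<and> W * mat_adjoint W = 1\<^sub>m n \<and> col W 0 = c \<cdot>\<^sub>v v"
proof -
  interpret cof_vec_space n "TYPE(complex)" .
  define b where "b = basis_completion v"
  define ws where "ws = gram_schmidt n b"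
  from basis_completion[OF v, folded b_def]
  have dist_b: "distinct b"
    and indep: "\<not> lin_dep (set b)" and b: "set b \<subseteq> carrier_vec n" and hdb: "hd b = v"
    and len_b: "length b = n" by auto
  from v have n: "n \<noteq> 0" by (auto simp: vec_eq_iff)
  from hdb len_b n obtain vs where bv: "b = v # vs" by (cases b, auto)
  from gram_schmidt_result[OF b dist_b indep refl, folded ws_def]
  have ws: "set ws \<subseteq> carrier_vec n" "corthogonal ws" "length ws = n"
    by (auto simp: len_b)
  from gram_schmidt_hd[OF v(1), of vs, folded bv] have hdws: "hd ws = v" unfolding ws_def .
  have wsi: "ws ! i \<in> carrier_vec n" if "i < n" for i using ws that by (auto simp: subset_iff)
  define nr where "nr i = sqrt (\<Sum>k<n. (cmod (ws ! i $ k))\<^sup>2)" for i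
  have sq: "(\<Sum>k<n. ws ! i $ k * cnj (ws ! i $ k)) = complex_of_real ((nr i)\<^sup>2)" for i
    by (simp add: nr_def sum_nonneg complex_norm_square del: of_real_power)
  have orth: "(\<Sum>k<n. ws ! i $ k * cnj (ws ! j $ k)) = 0 \<longleftrightarrow> i \<noteq> j" if "i < n" "j < n" for i j
    using corthogonalD[OF ws(2), of i j] ws(3) that wsi[of j]
    by (simp add: scalar_prod_def lessThan_atLeast0)
  have nr: "nr i \<noteq> 0" if "i < n" for i using orth[OF that that] sq[of i] by auto
  define W where "W = mat n n (\<lambda>(i, j). ws ! j $ i / complex_of_real (nr j))"
  have W: "W \<in> carrier_mat n n" by (simp add: W_def)
  have "mat_adjoint W * W = 1\<^sub>m n"
  proof (rule eq_matI)
    fix i j assume "i < dim_row (1\<^sub>m n :: complex mat)" "j < dim_col (1\<^sub>m n :: complex mat)"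
    then have ij: "i < n" "j < n" by auto
    have "(mat_adjoint W * W) $$ (i, j) = (\<Sum>k<n. ws ! j $ k * cnj (ws ! i $ k)) / (nr i * nr j)"
      using ij W by (simp add: scalar_prod_def lessThan_atLeast0 sum_divide_distrib) (simp add: W_def mult.commute)
    also have "\<dots> = (1\<^sub>m n :: complex mat) $$ (i, j)"
      using ij orth[of j i] sq[of i] nr[of i] by (auto simp: power2_eq_square)
    finally show "(mat_adjoint W * W) $$ (i, j) = (1\<^sub>m n :: complex mat) $$ (i, j)" .
  qed (use W in auto)
  moreover from mat_mult_left_right_inverse[OF mat_adjoint_carrier[OF W] W this]
  have "W * mat_adjoint W = 1\<^sub>m n" .
  moreover have "col W 0 = (1 / complex_of_real (nr 0)) \<cdot>\<^sub>v v"
    using n v hdws ws(3) by (intro eq_vecI) (auto simp: W_def hd_conv_nth[of ws] simp flip: length_0_conv)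
  ultimately show ?thesis using W by blast
qed

text \<open>Deflation: an eigenvector for the first root becomes the first column of a unitary
  matrix, and Hermitian symmetry clears the first row along with the first column. The diagonal
  follows the order of \<open>es\<close>, which later lets equal or nonzero eigenvalues be
  grouped.\<close>

lemma hermitian_diagonalization:
  fixes A :: "complex mat"
  assumes "A \<in> carrier_mat n n" "mat_adjoint A = A" "char_poly A = (\<Prod>e\<leftarrow>es. [:- e, 1:])"
  shows "\<exists>U\<in>carrier_mat n n. U * mat_adjoint U = 1\<^sub>m n \<and> mat_adjoint U * U = 1\<^sub>m n
    \<and> U * A * mat_adjoint U = mat_diag n ((!) es)"
  using assms
proof (induction es arbitrary: n A)
  case Nil
  from degree_monic_char_poly[OF Nil(1)] Nil(3) have n: "n = 0" by simp
  show ?case using Nil(1) n by (intro bexI[of _ "1\<^sub>m n"]) (auto intro!: eq_matI simp: mat_diag_def)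
next
  case (Cons e es)
  note A = Cons.prems(1)
  note mc = mult_carrier_mat[of _ n n _ n] and am = assoc_mult_mat[of _ n n _ n _ n]
  have mon: "monic (\<Prod>e\<leftarrow>es. [:- e, 1:])" by (rule monic_prod_list) auto
  have "degree (char_poly A) = Suc (degree (\<Prod>e\<leftarrow>es. [:- e, 1:]))"
    unfolding Cons.prems(3) list.map prod_list.Cons by (subst degree_mult_eq, insert mon, auto)
  with degree_monic_char_poly[OF A] obtain m where n: "n = Suc m" by metis
  have "eigenvalue A e" unfolding eigenvalue_root_char_poly[OF A] Cons.prems(3) by simp
  then obtain v where "eigenvector A v e" unfolding eigenvalue_def by auto
  then have v: "v \<in> carrier_vec n" "v \<noteq> 0\<^sub>v n" and Av: "A *\<^sub>v v = e \<cdot>\<^sub>v v"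
    using A by (auto simp: eigenvector_def)
  from unitary_completion[OF v] obtain W c where W: "W \<in> carrier_mat n n"
    and uni: "mat_adjoint W * W = 1\<^sub>m n" "W * mat_adjoint W = 1\<^sub>m n" and col: "col W 0 = c \<cdot>\<^sub>v v" by auto
  let ?W = "mat_adjoint W"
  have W': "?W \<in> carrier_mat n n" using W by simp
  define B where "B = ?W * A * W"
  have B: "B \<in> carrier_mat n n" using W A by (simp add: B_def mc)
  have Bh: "mat_adjoint B = B"
    using A W Cons.prems(2) by (simp add: B_def mat_adjoint_mult[of _ n n _ n] mc am)
  have "A *\<^sub>v col W 0 = e \<cdot>\<^sub>v col W 0"
    using A v Av unfolding col by (simp add: mult_mat_vec[of A n n] smult_smult_assoc mult.commute)
  then have AW: "col (A * W) 0 = e \<cdot>\<^sub>v col W 0" using A W n by (subst col_mult2[of _ n n _ n]) auto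
  have "B = ?W * (A * W)" using A W by (simp add: B_def am)
  then have "col B 0 = ?W *\<^sub>v (e \<cdot>\<^sub>v col W 0)"
    using col_mult2[OF W' mult_carrier_mat[OF A W], of 0] n by (simp add: AW)
  also have "\<dots> = e \<cdot>\<^sub>v (?W *\<^sub>v col W 0)"
    using W by (intro mult_mat_vec[OF W']) auto
  also have "?W *\<^sub>v col W 0 = col (1\<^sub>m n) 0" using n by (subst uni(1)[symmetric], subst col_mult2[OF W' W]) auto
  finally have B0: "B $$ (i, 0) = (if i = 0 then e else 0)" if "i < n" for i
    using that B n by (auto simp: vec_eq_iff)
  have B0': "B $$ (0, i) = (if i = 0 then cnj e else 0)" if "i < n" for i
    using B0[OF that] mat_adjoint_index[of 0 B i] B Bh that n by (auto split: if_splits)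
  define C where "C = mat m m (\<lambda>(i, j). B $$ (Suc i, Suc j))"
  have C: "C \<in> carrier_mat m m" by (simp add: C_def)
  define E where "E = mat 1 1 (\<lambda>_. e)"
  have E: "E \<in> carrier_mat 1 1" by (simp add: E_def)
  \<comment> \<open>The corner entry is read once from the first column and once from the first
    row.\<close>
  have "cnj e = e" using B0[of 0] B0'[of 0] n by simp
  have B_block: "B = four_block_mat E (0\<^sub>m 1 m) (0\<^sub>m m 1) C"
    using B B0 B0' n \<open>cnj e = e\<close> by (intro eq_matI) (auto simp: E_def C_def)
  have Ch: "mat_adjoint C = C"
  proof (rule eq_matI)
    fix i j assume "i < dim_row C" "j < dim_col C"
    then show "mat_adjoint C $$ (i, j) = C $$ (i, j)"
      using mat_adjoint_index[of "Suc i" B "Suc j"] B Bh n by (auto simp: C_def)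
  qed (auto simp: C_def)
  have "W * (?W * A) = A" using assoc_mult_mat[OF W W' A] uni(2) A by simp
  then have "A = W * B * ?W" using A W uni(2) by (simp add: B_def mc am)
  then have "similar_mat_wit A B W ?W" by (rule similar_mat_witI[OF uni(2,1) _ A B W W'])
  then have "char_poly A = char_poly B" by (intro char_poly_similar) (auto simp: similar_mat_def)
  also have "\<dots> = char_poly E * char_poly C"
    unfolding B_block by (rule char_poly_four_block_zeros_col[OF E _ C]) auto
  also have "char_poly E = [:- e, 1:]"
    by (simp add: E_def char_poly_defs det_def sign_def)
  finally have "[:- e, 1:] * char_poly C = [:- e, 1:] * (\<Prod>e\<leftarrow>es. [:- e, 1:])"
    unfolding Cons.prems(3) by simp
  then have "char_poly C = (\<Prod>e\<leftarrow>es. [:- e, 1:])"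
    by (subst (asm) mult_left_cancel) auto
  from Cons.IH[OF C Ch this] obtain V where V: "V \<in> carrier_mat m m" "V * mat_adjoint V = 1\<^sub>m m"
    "mat_adjoint V * V = 1\<^sub>m m" and VCV: "V * C * mat_adjoint V = mat_diag m ((!) es)" by auto
  \<comment> \<open>The unitary for the smaller block is extended by a 1 that fixes the eigenvector
    already split off.\<close>
  define Z where "Z = four_block_mat (1\<^sub>m 1) (0\<^sub>m 1 m) (0\<^sub>m m 1) V"
  have Z: "Z \<in> carrier_mat n n" using four_block_carrier_mat[of "1\<^sub>m 1" 1 1 V m m] V n by (simp add: Z_def)
  have Z': "mat_adjoint Z = four_block_mat (1\<^sub>m 1) (0\<^sub>m 1 m) (0\<^sub>m m 1) (mat_adjoint V)"
    using V n by (intro eq_matI) (auto simp: Z_def)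
  have ZZ: "Z * mat_adjoint Z = 1\<^sub>m n"
    unfolding Z' unfolding Z_def
    using V n by (subst mult_four_block_mat[of _ 1 1 _ m _ m _ _ 1 _ m]) simp_all
  have "V * C * mat_adjoint V \<in> carrier_mat m m" by (simp add: VCV)
  then have "Z * B * mat_adjoint Z = four_block_mat E (0\<^sub>m 1 m) (0\<^sub>m m 1) (V * C * mat_adjoint V)"
    unfolding Z' unfolding Z_def B_block using V C E
    by (subst mult_four_block_mat[of _ 1 1 _ m _ m _ _ 1 _ m], simp_all)
      (subst mult_four_block_mat[of _ 1 1 _ m _ m _ _ 1 _ m], simp_all)
  also have "\<dots> = mat_diag n ((!) (e # es))"
    unfolding VCV using n by (intro eq_matI) (auto simp: mat_diag_def E_def nth_Cons')
  finally have D: "Z * B * mat_adjoint Z = mat_diag n ((!) (e # es))" .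
  define U where "U = Z * ?W"
  have U: "U \<in> carrier_mat n n" using Z W by (simp add: U_def mc)
  have adU: "mat_adjoint U = W * mat_adjoint Z"
    using Z W by (simp add: U_def mat_adjoint_mult[of _ n n _ n])
  have UU: "U * mat_adjoint U = 1\<^sub>m n"
  proof -
    have "U * mat_adjoint U = Z * (?W * W) * mat_adjoint Z"
      unfolding adU unfolding U_def using Z W by (simp add: mc am)
    then show ?thesis using Z by (simp add: uni ZZ)
  qed
  moreover have "U * A * mat_adjoint U = mat_diag n ((!) (e # es))"
    unfolding adU D[symmetric] unfolding U_def B_def using Z W A
    by (simp add: mc am)
  moreover have "mat_adjoint U * U = 1\<^sub>m n"
    using mat_mult_left_right_inverse[OF U mat_adjoint_carrier[OF U] UU] .
  ultimately show ?case using U by blast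
qed

section \<open>The star algebra of complex matrices of size six\<close>

text \<open>Fixing the size makes all operations total, so these matrices form a
  \<open>real_algebra_1\<close> and the locale \<open>cubic_pencil\<close> applies to them. Column
  vectors will be matrices with one nonzero column.\<close>

typedef mat6 = "carrier_mat 6 6 :: complex mat set"
  morphisms to_mat of_mat by (rule exI[of _ "0\<^sub>m 6 6"]) simp

setup_lifting type_definition_mat6

instantiation mat6 :: real_algebra_1
begin

lift_definition zero_mat6 :: mat6 is "0\<^sub>m 6 6" by simp
lift_definition one_mat6 :: mat6 is "1\<^sub>m 6" by simp
lift_definition plus_mat6 :: "mat6 \<Rightarrow> mat6 \<Rightarrow> mat6" is "(+)" by simp
lift_definition minus_mat6 :: "mat6 \<Rightarrow> mat6 \<Rightarrow> mat6" is "(-)" by (rule minus_carrier_mat)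
lift_definition uminus_mat6 :: "mat6 \<Rightarrow> mat6" is uminus by simp
lift_definition times_mat6 :: "mat6 \<Rightarrow> mat6 \<Rightarrow> mat6" is "(*)" by (rule mult_carrier_mat)
lift_definition scaleR_mat6 :: "real \<Rightarrow> mat6 \<Rightarrow> mat6" is "\<lambda>c A. complex_of_real c \<cdot>\<^sub>m A" by simp

instance
proof
  fix a b c :: mat6 and r s :: real
  show "a + b + c = a + (b + c)" by transfer (rule assoc_add_mat)
  show "a + b = b + a" by transfer (rule comm_add_mat)
  show "0 + a = a" by transfer simp
  show "- a + a = 0" by transfer (rule uminus_l_inv_mat)
  show "a - b = a + - b" by transfer (auto intro!: eq_matI)
  show "r *\<^sub>R (a + b) = r *\<^sub>R a + r *\<^sub>R b" by transfer (auto intro!: eq_matI simp: algebra_simps)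
  show "(r + s) *\<^sub>R a = r *\<^sub>R a + s *\<^sub>R a" by transfer (auto intro!: eq_matI simp: algebra_simps)
  show "r *\<^sub>R s *\<^sub>R a = (r * s) *\<^sub>R a" by transfer (auto intro!: eq_matI)
  show "1 *\<^sub>R a = a" by transfer (auto intro!: eq_matI)
  show "a * b * c = a * (b * c)" by transfer (rule assoc_mult_mat)
  show "1 * a = a" "a * 1 = a" by (transfer, simp)+
  show "(a + b) * c = a * c + b * c" by transfer (rule add_mult_distrib_mat)
  show "a * (b + c) = a * b + a * c" by transfer (rule mult_add_distrib_mat)
  show "r *\<^sub>R a * b = r *\<^sub>R (a * b)" by transfer (rule mult_smult_assoc_mat)
  show "a * r *\<^sub>R b = r *\<^sub>R (a * b)" by transfer (rule mult_smult_distrib)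
  show "(0::mat6) \<noteq> 1"
  proof transfer
    have "(0\<^sub>m 6 6 :: complex mat) $$ (0, 0) \<noteq> 1\<^sub>m 6 $$ (0, 0)" by simp
    then show "(0\<^sub>m 6 6 :: complex mat) \<noteq> 1\<^sub>m 6" by metis
  qed
qed

end

lift_definition adj :: "mat6 \<Rightarrow> mat6" is mat_adjoint by simp
lift_definition ent :: "mat6 \<Rightarrow> nat \<Rightarrow> nat \<Rightarrow> complex" is "\<lambda>A i j. A $$ (i, j)" .
lift_definition dg :: "(nat \<Rightarrow> real) \<Rightarrow> mat6" is "\<lambda>f. mat_diag 6 (\<lambda>i. complex_of_real (f i))" by simp
text \<open>Scalars of \<open>mat6\<close> are real; this central matrix supplies the complex
  ones.\<close>

lift_definition imag_unit :: mat6 is "\<i> \<cdot>\<^sub>m 1\<^sub>m 6" by simp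

lemma to_mat_carrier [simp]: "to_mat A \<in> carrier_mat 6 6"
  using to_mat by blast

lemma mat6_eqI: "(\<And>i j. i < 6 \<Longrightarrow> j < 6 \<Longrightarrow> ent A i j = ent B i j) \<Longrightarrow> A = B"
  by transfer (auto intro!: eq_matI)

lemma ent_simps [simp]:
  assumes "i < 6" "j < 6"
  shows "ent 0 i j = 0" "ent 1 i j = (if i = j then 1 else 0)" "ent (A + B) i j = ent A i j + ent B i j"
    "ent (A - B) i j = ent A i j - ent B i j" "ent (- A) i j = - ent A i j"
    "ent (c *\<^sub>R A) i j = of_real c * ent A i j" "ent (adj A) i j = cnj (ent A j i)"
    "ent (dg f) i j = (if i = j then of_real (f i) else 0)"
    "ent imag_unit i j = (if i = j then \<i> else 0)"
  using assms by (transfer, auto simp: mat_diag_def)+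

lemma ent_mult: "i < 6 \<Longrightarrow> j < 6 \<Longrightarrow> ent (A * B) i j = (\<Sum>k<6. ent A i k * ent B k j)"
  by transfer (auto simp: scalar_prod_def lessThan_atLeast0)

lemma ent_dg_mult [simp]: "i < 6 \<Longrightarrow> j < 6 \<Longrightarrow> ent (dg f * A) i j = of_real (f i) * ent A i j"
  by (simp add: ent_mult if_distrib[of "\<lambda>x. x * _"] cong: if_cong)

lemma ent_mult_dg [simp]: "i < 6 \<Longrightarrow> j < 6 \<Longrightarrow> ent (A * dg f) i j = ent A i j * of_real (f j)"
  by (simp add: ent_mult if_distrib[of "\<lambda>x. _ * x"] cong: if_cong)

lemma dg_mult [simp]: "dg f * dg g = dg (\<lambda>i. f i * g i)"
  by (rule mat6_eqI) simp

lemma dg_add: "dg f + dg g = dg (\<lambda>i. f i + g i)" and dg_scaleR: "c *\<^sub>R dg f = dg (\<lambda>i. c * f i)"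
  by (rule mat6_eqI; simp)+

lemma dg_cong: "(\<And>i. i < 6 \<Longrightarrow> f i = g i) \<Longrightarrow> dg f = dg g"
  by (rule mat6_eqI) simp

lemma dg_const_0 [simp]: "dg (\<lambda>_. 0) = 0" and dg_const_1 [simp]: "dg (\<lambda>_. 1) = 1"
  by (rule mat6_eqI; simp)+

lemma imag_unit_central: "imag_unit * A = A * imag_unit"
  by (rule mat6_eqI) (simp add: ent_mult if_distrib[of "\<lambda>x. x * _"] if_distrib[of "\<lambda>x. _ * x"] cong: if_cong)

lemma imag_unit_square: "imag_unit * imag_unit = - 1"
  by (rule mat6_eqI) (simp add: ent_mult if_distrib[of "\<lambda>x. x * _"] if_distrib[of "\<lambda>x. _ * x"] cong: if_cong)

lemma adj_adj [simp]: "adj (adj A) = A"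
  by (rule mat6_eqI) simp

lemma adj_mult [simp]: "adj (A * B) = adj B * adj A"
  by transfer (rule mat_adjoint_mult)

lemma adj_simps [simp]: "adj 0 = 0" "adj 1 = 1" "adj (A + B) = adj A + adj B" "adj (A - B) = adj A - adj B"
    "adj (- A) = - adj A" "adj (c *\<^sub>R A) = c *\<^sub>R adj A" "adj (dg f) = dg f" "adj imag_unit = - imag_unit"
  by (rule mat6_eqI; simp)+

lemma ent_adj_mult_self: "j < 6 \<Longrightarrow> ent (adj A * A) j j = of_real (\<Sum>k<6. (cmod (ent A k j))\<^sup>2)"
  by (simp add: ent_mult complex_norm_square mult.commute del: of_real_power)

text \<open>The diagonal entry \<open>(j, j)\<close> of the sum adds the squared norms of the
  \<open>j\<close>-th columns of all summands, so each column vanishes.\<close>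

lemma sum_adj_mult_self_eq_0:
  assumes "(\<Sum>z\<leftarrow>zs. adj z * z) = 0" "z \<in> set zs"
  shows "z = 0"
proof (rule mat6_eqI)
  fix i j :: nat assume ij: "i < 6" "j < 6"
  define q where "q z = (\<Sum>k<6. (cmod (ent z k j))\<^sup>2)" for z
  have "ent (\<Sum>z\<leftarrow>zs. adj z * z) j j = of_real (\<Sum>z\<leftarrow>zs. q z)" for zs
    by (induction zs) (use ij in \<open>simp_all add: ent_adj_mult_self q_def\<close>)
  then have "(\<Sum>z\<leftarrow>zs. q z) = 0" using assms(1) ij by (metis ent_simps(1) of_real_eq_0_iff)
  moreover have "q z \<ge> 0" for z by (simp add: q_def sum_nonneg)
  ultimately have "\<forall>x\<in>set (map q zs). x = 0" by (subst (asm) sum_list_nonneg_eq_0_iff) auto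
  then have "q z = 0" using assms(2) by simp
  then show "ent z i j = ent 0 i j" using ij by (simp add: q_def sum_nonneg_eq_0_iff)
qed

lemma adj_mult_self_eq_0: "adj z * z = 0 \<Longrightarrow> z = 0"
  using sum_adj_mult_self_eq_0[of "[z]" z] by simp

section \<open>Spectral theorem and eigenvectors in \<open>mat6\<close>\<close>

lemma spectral_mat6:
  assumes "adj A = A" "char_poly (to_mat A) = (\<Prod>e\<leftarrow>es. [:- e, 1:])"
  shows "\<exists>U. U * adj U = 1 \<and> adj U * U = 1 \<and> U * A * adj U = dg (\<lambda>i. Re (es ! i))
    \<and> (\<forall>e\<in>set es. e \<in> \<real>)"
proof -
  have "degree (char_poly (to_mat A)) = 6"
    using degree_monic_char_poly[of "to_mat A" 6] by simp
  moreover have "degree (\<Prod>e\<leftarrow>es. [:- e, 1:]) = length es"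
    by (simp add: degree_linear_factors)
  ultimately have len: "length es = 6" using assms(2) by simp
  have "mat_adjoint (to_mat A) = to_mat A" using assms(1) by (metis adj.rep_eq)
  from hermitian_diagonalization[OF to_mat_carrier this assms(2)] obtain V where V: "V \<in> carrier_mat 6 6"
    "V * mat_adjoint V = 1\<^sub>m 6" "mat_adjoint V * V = 1\<^sub>m 6"
    "V * to_mat A * mat_adjoint V = mat_diag 6 ((!) es)" by auto
  define U where "U = of_mat V"
  have tU: "to_mat U = V" using V by (simp add: U_def of_mat_inverse)
  have 1: "U * adj U = 1" "adj U * U = 1"
    using V by (simp_all flip: to_mat_inject add: times_mat6.rep_eq adj.rep_eq one_mat6.rep_eq tU)
  have 2: "to_mat (U * A * adj U) = mat_diag 6 ((!) es)"
    using V by (simp add: times_mat6.rep_eq adj.rep_eq tU)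
  have e: "ent (U * A * adj U) i j = (if i = j then es ! i else 0)" if "i < 6" "j < 6" for i j
    using that by (simp add: ent.rep_eq 2 mat_diag_def)
  have herm: "adj (U * A * adj U) = U * A * adj U" using assms(1) by (simp add: mult.assoc)
  \<comment> \<open>These are diagonal entries of a Hermitian matrix, hence real, which is why
    \<open>dg\<close> of real parts loses nothing.\<close>
  have r: "cnj (es ! i) = es ! i" if "i < 6" for i
    using arg_cong[OF herm, of "\<lambda>B. ent B i i"] e[of i i] that ent_simps(7)[of i i "U * A * adj U"] by simp
  have "U * A * adj U = dg (\<lambda>i. Re (es ! i))"
    by (rule mat6_eqI) (use e r in \<open>simp add: complex_eq_iff\<close>)
  moreover have "\<forall>e\<in>set es. e \<in> \<real>"
    using r len by (auto simp: in_set_conv_nth Reals_cnj_iff)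
  ultimately show ?thesis using 1 by blast
qed

lemma poly_char_poly:
  fixes A :: "complex mat"
  assumes A: "A \<in> carrier_mat n n"
  shows "poly (char_poly A) c = det (c \<cdot>\<^sub>m 1\<^sub>m n - A)"
proof -
  have hom: "comm_ring_hom (\<lambda>p. poly p c)" by unfold_locales auto
  have "map_mat (\<lambda>p. poly p c) (char_poly_matrix A) = c \<cdot>\<^sub>m 1\<^sub>m n - A"
    using A by (intro eq_matI) (auto simp: char_poly_matrix_def)
  then show ?thesis unfolding char_poly_def by (simp add: comm_ring_hom.hom_det[OF hom, symmetric])
qed

text \<open>In a unitary eigenbasis \<open>A\<close> is real diagonal, so the product of the factors
  \<open>A - e\<close> vanishes as soon as every eigenvalue occurs in the list once, whatever its
  multiplicity. The \<open>fold\<close> applies this product to \<open>x\<close>, so that the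
  intermediate vectors are available too.\<close>

lemma hermitian_annihilated:
  assumes A: "adj A = A"
    and roots: "\<And>c. poly (char_poly (to_mat A)) (complex_of_real c) = 0 \<Longrightarrow> c \<in> set es"
  shows "fold (\<lambda>e x. A * x - e *\<^sub>R x) es x = 0"
proof -
  obtain fs where fs: "char_poly (to_mat A) = (\<Prod>e\<leftarrow>fs. [:- e, 1:])" "length fs = 6"
    using char_poly_factorized[of "to_mat A" 6] by auto
  from spectral_mat6[OF A fs(1)] obtain U where U: "U * adj U = 1" "adj U * U = 1"
    "U * A * adj U = dg (\<lambda>i. Re (fs ! i))" "\<forall>e\<in>set fs. e \<in> \<real>" by auto
  define d where "d i = Re (fs ! i)" for i
  have UA: "U * A = dg d * U"
  proof -
    have "U * A = U * A * (adj U * U)" by (simp add: U)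
    also have "\<dots> = (U * A * adj U) * U" by (simp only: mult.assoc)
    also have "\<dots> = dg d * U" by (simp add: U d_def[abs_def])
    finally show ?thesis .
  qed
  have d: "d i \<in> set es" if "i < 6" for i
  proof -
    have "fs ! i \<in> set fs" using that fs by simp
    moreover from this have "complex_of_real (d i) = fs ! i" using U(4) by (simp add: d_def)
    ultimately have "poly (char_poly (to_mat A)) (complex_of_real (d i)) = 0"
      unfolding fs(1) poly_prod_list by (simp add: prod_list_zero_iff image_iff)
    then show ?thesis by (rule roots)
  qed
  have *: "U * fold (\<lambda>e x. A * x - e *\<^sub>R x) es x = dg (\<lambda>i. \<Prod>e\<leftarrow>es. d i - e) * (U * x)" for es x
  proof (induction es arbitrary: x)
    case (Cons e es)
    have "U * (A * x - e *\<^sub>R x) = dg (\<lambda>i. d i - e) * (U * x)"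
    proof -
      have "U * (A * x) = dg d * (U * x)" by (metis UA mult.assoc)
      then show ?thesis by (intro mat6_eqI) (simp add: right_diff_distrib left_diff_distrib)
    qed
    then have "U * fold (\<lambda>e x. A * x - e *\<^sub>R x) (e # es) x
        = (dg (\<lambda>i. \<Prod>e\<leftarrow>es. d i - e) * dg (\<lambda>i. d i - e)) * (U * x)"
      using Cons[of "A * x - e *\<^sub>R x"] by (simp only: fold_simps mult.assoc)
    then show ?case by (simp add: mult.commute)
  qed simp
  moreover have "dg (\<lambda>i. \<Prod>e\<leftarrow>es. d i - e) = dg (\<lambda>_. 0)"
    by (rule dg_cong) (use d in \<open>auto simp: prod_list_zero_iff\<close>)
  ultimately have "adj U * (U * fold (\<lambda>e x. A * x - e *\<^sub>R x) es x) = 0" by simp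
  then show ?thesis by (simp add: mult.assoc[symmetric] U)
qed

text \<open>Apply the factors \<open>A - c\<close> of an annihilating product to \<open>x\<close>
  one after another: the last vector before zero is an eigenvector, and it has never left
  \<open>S\<close>.\<close>

lemma hermitian_eigenvector_in:
  assumes A: "adj A = A" and S: "x \<in> S" "x \<noteq> 0" "\<And>x c::real. x \<in> S \<Longrightarrow> A * x - c *\<^sub>R x \<in> S"
  shows "\<exists>u\<in>S. u \<noteq> 0 \<and> (\<exists>c::real. A * u = c *\<^sub>R u)"
proof -
  have "finite {c. poly (char_poly (to_mat A)) (complex_of_real c) = 0}"
  proof (rule finite_imageD)
    have "char_poly (to_mat A) \<noteq> 0" using degree_monic_char_poly[of "to_mat A" 6] by auto
    then show "finite (complex_of_real ` {c. poly (char_poly (to_mat A)) (complex_of_real c) = 0})"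
      by (rule finite_subset[OF _ poly_roots_finite, rotated]) auto
  qed (auto simp: inj_on_def)
  then obtain es where "set es = {c. poly (char_poly (to_mat A)) (complex_of_real c) = 0}"
    using finite_list by blast
  with hermitian_annihilated[OF A] have "fold (\<lambda>e x. A * x - e *\<^sub>R x) es x = 0" by blast
  then show ?thesis using S(1,2)
  proof (induction es arbitrary: x)
    case (Cons e es)
    show ?case
    proof (cases "A * x - e *\<^sub>R x = 0")
      case True
      then show ?thesis using Cons.prems by (intro bexI[of _ x]) auto
    next
      case False
      then show ?thesis using Cons.IH[of "A * x - e *\<^sub>R x"] Cons.prems S(3) by auto
    qed
  qed simp
qed

section \<open>Reducing subspaces\<close>

text \<open>The kernel of \<open>N\<close> is a proper nonzero subspace invariant under
  \<open>X\<close> and \<open>Y\<close>. In an eigenbasis of \<open>N\<close> with the nonzero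
  eigenvalues first, it is spanned by the last \<open>6 - r\<close> basis vectors; invariance clears
  one off-diagonal block and Hermitian symmetry the other.\<close>

lemma invariant_split:
  assumes N: "adj N = N" "N \<noteq> 0" and w: "w \<noteq> 0" "N * w = 0"
    and inv: "\<And>w. N * w = 0 \<Longrightarrow> N * (X * w) = 0" "\<And>w. N * w = 0 \<Longrightarrow> N * (Y * w) = 0"
    and herm: "adj X = X" "adj Y = Y"
  shows "\<exists>U r. U * adj U = 1 \<and> adj U * U = 1 \<and> 0 < r \<and> r < 6 \<and>
    (\<forall>i<6. \<forall>j<6. (i < r) \<noteq> (j < r) \<longrightarrow> ent (U * X * adj U) i j = 0 \<and> ent (U * Y * adj U) i j = 0)"
proof -
  obtain fs where fs: "char_poly (to_mat N) = (\<Prod>e\<leftarrow>fs. [:- e, 1:])" "length fs = 6"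
    using char_poly_factorized[of "to_mat N" 6] by auto
  define as where "as = filter (\<lambda>e. e \<noteq> 0) fs"
  define bs where "bs = filter (\<lambda>e. e = 0) fs"
  define r where "r = length as"
  \<comment> \<open>The linear factors are reordered so that the zero eigenvalues come last.\<close>
  have "(\<Prod>e\<leftarrow>filter (\<lambda>e. e \<noteq> 0) fs @ filter (\<lambda>e. e = 0) fs. g e) = (\<Prod>e\<leftarrow>fs. g e)"
    for fs and g :: "complex \<Rightarrow> complex poly"
    by (induction fs) (simp_all add: ac_simps)
  from this[of "\<lambda>e. [:- e, 1:]"] have cp: "char_poly (to_mat N) = (\<Prod>e\<leftarrow>as @ bs. [:- e, 1:])" by (simp add: fs as_def bs_def)
  from spectral_mat6[OF N(1) cp] obtain U where U: "U * adj U = 1" "adj U * U = 1"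
    and D: "U * N * adj U = dg (\<lambda>i. Re ((as @ bs) ! i))" and real: "\<forall>e\<in>set (as @ bs). e \<in> \<real>" by auto
  define d where "d i = Re ((as @ bs) ! i)" for i
  have len: "length (as @ bs) = 6"
    using fs(2) sum_length_filter_compl[of "\<lambda>e. e \<noteq> 0" fs] by (simp add: as_def bs_def)
  have d: "d i \<noteq> 0 \<longleftrightarrow> i < r" if "i < 6" for i
  proof (cases "i < r")
    case True
    then have "as ! i \<in> set as" by (simp add: r_def)
    moreover from this have "as ! i \<noteq> 0" by (simp add: as_def)
    ultimately show ?thesis using True real by (auto simp: d_def nth_append r_def complex_is_Real_iff complex_eq_iff)
  next
    case False
    then have "bs ! (i - r) \<in> set bs" using len that by (intro nth_mem) (auto simp: r_def)
    then show ?thesis using False by (simp add: d_def nth_append r_def bs_def)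
  qed
  have N_eq: "N = adj U * dg d * U"
  proof -
    have "N = adj U * U * N * (adj U * U)" by (simp add: U)
    also have "\<dots> = adj U * (U * N * adj U) * U" by (simp only: mult.assoc)
    finally show ?thesis by (simp add: D d_def[abs_def])
  qed
  have UN: "U * N = dg d * U" unfolding N_eq by (simp add: U mult.assoc[symmetric])
  have r0: "r > 0"
  proof (rule ccontr)
    assume "\<not> r > 0"
    then have "dg d = dg (\<lambda>_. 0)" using d by (intro dg_cong) auto
    then show False using N(2) by (simp add: N_eq)
  qed
  have r6: "r < 6"
  proof (rule ccontr)
    assume "\<not> r < 6"
    \<comment> \<open>Without a zero eigenvalue the diagonal matrix would be invertible and
      \<open>N * w = 0\<close> would give \<open>w = 0\<close>.\<close>
    then have "dg (\<lambda>i. 1 / d i) * dg d = dg (\<lambda>_. 1)" using d unfolding dg_mult by (intro dg_cong) auto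
    then have "U * w = dg (\<lambda>i. 1 / d i) * (dg d * U) * w" by (simp add: mult.assoc[symmetric])
    also have "\<dots> = 0" unfolding UN[symmetric] by (simp add: mult.assoc w)
    finally have "adj U * (U * w) = 0" by simp
    then show False using w by (simp add: mult.assoc[symmetric] U)
  qed
  have zero: "ent (U * Z * adj U) i j = 0"
    if inv: "\<And>w. N * w = 0 \<Longrightarrow> N * (Z * w) = 0" and herm: "adj Z = Z" and ij: "i < 6" "j < 6" "(i < r) \<noteq> (j < r)" for Z i j
  proof -
    have *: "ent (U * Z * adj U) i j = 0" if ij: "i < r" "\<not> j < r" "i < 6" "j < 6" for i j
    proof -
      \<comment> \<open>\<open>adj U * e\<close> keeps only column \<open>j\<close> of
        \<open>adj U\<close>, an eigenvector of \<open>N\<close> with eigenvalue zero.\<close>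
      define e where "e = dg (\<lambda>k. if k = j then 1 else 0)"
      have "dg d * e = dg (\<lambda>_. 0)" unfolding e_def dg_mult using d that by (intro dg_cong) auto
      then have "N * (adj U * e) = 0" by (simp add: N_eq mult.assoc) (simp add: U mult.assoc[symmetric])
      from inv[OF this] have "U * (N * (Z * (adj U * e))) = 0" by simp
      then have "dg d * (U * Z * adj U * e) = 0" by (simp add: mult.assoc[symmetric] UN)
      then have "ent (dg d * (U * Z * adj U * e)) i j = 0" using ij by simp
      then show ?thesis using ij d[of i] by (simp add: e_def)
    qed
    have "adj (U * Z * adj U) = U * Z * adj U" using herm by (simp add: mult.assoc)
    then have "ent (U * Z * adj U) i j = cnj (ent (U * Z * adj U) j i)"
      using ij by (metis ent_simps(7))
    then show ?thesis using *[of i j] *[of j i] ij by auto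
  qed
  have "\<forall>i<6. \<forall>j<6. (i < r) \<noteq> (j < r) \<longrightarrow> ent (U * X * adj U) i j = 0 \<and> ent (U * Y * adj U) i j = 0"
    by (intro allI impI conjI; rule zero) (use inv herm in blast)+
  with r0 r6 U show ?thesis by (intro exI[of _ U] exI[of _ r] conjI)
qed

text \<open>\<open>P_diag\<close> places the eigenspace for \<open>p\<close> in the first two
  coordinates. Its dimension two is what leaves room for a vector orthogonal to the common
  eigenvector found below.\<close>

locale hermitian_cubic_pencil = cubic_pencil X Y P Q R p q r b1 b2 b3 c2 c3 d3
  for X Y P Q R :: mat6 and p q r b1 b2 b3 c2 c3 d3 +
  assumes herm: "adj X = X" "adj Y = Y" "adj P = P" "adj Q = Q" "adj R = R"
    and P_diag: "P = dg (\<lambda>i. if i < 2 then 1 else 0)"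
begin

text \<open>A matrix \<open>x\<close> with \<open>x * e0 = x\<close> has only one nonzero column, so it encodes a column vector.\<close>

definition "e0 = dg (\<lambda>i. if i = 0 then 1 else 0)"

text \<open>By \<open>loop_commutator\<close>, \<open>\<gamma>\<close> preserves a suitable
  eigenspace of \<open>\<alpha>\<close>. There \<open>\<gamma> + \<gamma>'\<close> is a real scalar,
  so diagonalising the Hermitian matrix \<open>imag_unit * (\<gamma> - \<gamma>')\<close>
  diagonalises \<open>\<gamma>\<close> and its adjoint \<open>\<gamma>'\<close> together. Their
  eigenvalues may be complex and therefore appear as right factors \<open>s\<close> and
  \<open>s'\<close>.\<close>

lemma common_eigenvector:
  defines "\<alpha> \<equiv> P * Y * Q * Y * P" and "\<gamma> \<equiv> P * Y * Q * Y * R * Y * P" and "\<gamma>' \<equiv> P * Y * R * Y * Q * Y * P"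
  shows "\<exists>u a s s'. u \<noteq> 0 \<and> P * u = u \<and> u * e0 = u \<and> \<alpha> * u = a *\<^sub>R u \<and> \<gamma> * u = u * s \<and> \<gamma>' * u = u * s'"
proof -
  have adj: "adj \<alpha> = \<alpha>" "adj \<gamma> = \<gamma>'" "adj \<gamma>' = \<gamma>"
    by (simp_all add: \<alpha>_def \<gamma>_def \<gamma>'_def herm mult.assoc)
  have P: "P * \<alpha> = \<alpha>" "P * \<gamma> = \<gamma>" by (simp_all add: \<alpha>_def \<gamma>_def mult.assoc idem')
  define S where "S = {x. P * x = x \<and> x * e0 = x}"
  have "e0 \<in> S" "e0 \<noteq> 0"
  proof -
    show "e0 \<in> S" unfolding S_def e0_def P_diag dg_mult by (auto intro!: dg_cong)
    have "ent e0 0 0 \<noteq> ent 0 0 0" by (simp add: e0_def)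
    then show "e0 \<noteq> 0" by metis
  qed
  moreover have "\<alpha> * x - c *\<^sub>R x \<in> S" if "x \<in> S" for x and c :: real
    using that P by (simp add: S_def algebra_simps) (simp add: mult.assoc[symmetric])
  ultimately obtain x0 and a :: real where x0: "x0 \<in> S" "x0 \<noteq> 0" "\<alpha> * x0 = a *\<^sub>R x0"
    using hermitian_eigenvector_in[OF adj(1)] by metis
  obtain k c where comm: "\<gamma> * \<alpha> - \<alpha> * \<gamma> = k *\<^sub>R (\<alpha> * \<alpha>) + c *\<^sub>R \<alpha>"
    using loop_commutator unfolding \<alpha>_def \<gamma>_def by blast
  \<comment> \<open>On an eigenvector of \<open>\<alpha>\<close> the right-hand side of the
    commutator relation is the scalar \<open>k a a + c a\<close>.\<close>
  have comm': "a *\<^sub>R (\<gamma> * x) - \<alpha> * (\<gamma> * x) = (k * a * a + c * a) *\<^sub>R x" if "\<alpha> * x = a *\<^sub>R x" for x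
  proof -
    have "(\<gamma> * \<alpha> - \<alpha> * \<gamma>) * x = (k *\<^sub>R (\<alpha> * \<alpha>) + c *\<^sub>R \<alpha>) * x" by (simp only: comm)
    then show ?thesis using that by (simp add: algebra_simps)
  qed
  \<comment> \<open>\<open>a\<close> is real and \<open>\<alpha>\<close> is Hermitian, so the range of \<open>a - \<alpha>\<close> is orthogonal to \<open>x0\<close>.\<close>
  have f0: "k * a * a + c * a = 0"
  proof -
    have "adj x0 * \<alpha> = a *\<^sub>R adj x0" using arg_cong[OF x0(3), of adj] adj by simp
    then have "adj x0 * (a *\<^sub>R (\<gamma> * x0) - \<alpha> * (\<gamma> * x0)) = 0"
      by (simp add: right_diff_distrib mult.assoc[symmetric])
    then have "(k * a * a + c * a) *\<^sub>R (adj x0 * x0) = 0" by (simp add: comm'[OF x0(3)])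
    then show ?thesis using adj_mult_self_eq_0[of x0] x0(2) unfolding scaleR_eq_0_iff by blast
  qed
  define T where "T = {x. x \<in> S \<and> \<alpha> * x = a *\<^sub>R x}"
  have \<gamma>T: "\<gamma> * x \<in> T" if "x \<in> T" for x
  proof -
    have "\<alpha> * (\<gamma> * x) = a *\<^sub>R (\<gamma> * x)" using comm'[of x] f0 that by (simp add: T_def)
    moreover have "P * (\<gamma> * x) = \<gamma> * x" using P(2) by (metis mult.assoc)
    moreover have "\<gamma> * x * e0 = \<gamma> * x" using that by (simp add: T_def S_def mult.assoc)
    ultimately show ?thesis by (simp add: T_def S_def)
  qed
  obtain k' c' where loop: "\<gamma> + \<gamma>' = k' *\<^sub>R \<alpha> + c' *\<^sub>R P"
    using cubic_loop unfolding \<alpha>_def \<gamma>_def \<gamma>'_def by blast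
  have loop': "\<gamma>' * x = (k' * a + c') *\<^sub>R x - \<gamma> * x" if "x \<in> T" for x
  proof -
    have "(\<gamma> + \<gamma>') * x = (k' *\<^sub>R \<alpha> + c' *\<^sub>R P) * x" by (simp only: loop)
    then show ?thesis using that by (simp add: T_def S_def algebra_simps)
  qed
  have lin: "x - y \<in> T" "c *\<^sub>R x \<in> T" if "x \<in> T" "y \<in> T" for x y and c :: real
    using that unfolding T_def S_def by (simp_all add: algebra_simps)
  have iT: "imag_unit * x \<in> T" if "x \<in> T" for x
  proof -
    have "Z * (imag_unit * x) = imag_unit * (Z * x)" for Z
      using imag_unit_central[of Z] by (metis mult.assoc)
    then show ?thesis using that by (simp add: T_def S_def mult.assoc)
  qed
  define \<Gamma> where "\<Gamma> = imag_unit * (\<gamma> - \<gamma>')"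
  have "adj \<Gamma> = \<Gamma>"
    unfolding \<Gamma>_def using imag_unit_central[of "\<gamma> - \<gamma>'"] by (simp add: adj algebra_simps)
  moreover have "\<Gamma> * x - c *\<^sub>R x \<in> T" if "x \<in> T" for x and c :: real
  proof -
    have "\<Gamma> * x = imag_unit * (\<gamma> * x - \<gamma>' * x)" by (simp add: \<Gamma>_def algebra_simps)
    moreover have "\<gamma>' * x \<in> T" unfolding loop'[OF that] using that \<gamma>T by (intro lin)
    ultimately show ?thesis using that \<gamma>T by (simp add: lin iT)
  qed
  moreover have "x0 \<in> T" using x0 by (simp add: T_def)
  ultimately obtain u and g :: real where u: "u \<in> T" "u \<noteq> 0" "\<Gamma> * u = g *\<^sub>R u"
    using hermitian_eigenvector_in[of \<Gamma> x0 T] x0(2) by metis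
  have "imag_unit * (\<Gamma> * u) = (imag_unit * imag_unit) * ((\<gamma> - \<gamma>') * u)"
    by (simp only: \<Gamma>_def mult.assoc)
  also have "\<dots> = - (\<gamma> * u - \<gamma>' * u)" by (simp add: imag_unit_square left_diff_distrib)
  finally have d: "\<gamma> * u - \<gamma>' * u = - (g *\<^sub>R (u * imag_unit))"
    using u(3) imag_unit_central[of u] by simp
  \<comment> \<open>Half the sum of \<open>\<gamma> + \<gamma>'\<close>, acting on \<open>u\<close>
    as \<open>k' * a + c'\<close>, and \<open>\<gamma> - \<gamma>'\<close>, acting as
    \<open>- g\<close> times \<open>imag_unit\<close>.\<close>
  define s where "s = (1 / 2) *\<^sub>R ((k' * a + c') *\<^sub>R 1 - g *\<^sub>R imag_unit)"
  have "2 *\<^sub>R (\<gamma> * u) = (k' * a + c') *\<^sub>R u - g *\<^sub>R (u * imag_unit)"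
    using d loop'[OF u(1)] by (simp add: scaleR_2 algebra_simps)
  then have "(1 / 2) *\<^sub>R 2 *\<^sub>R (\<gamma> * u) = u * s" by (simp only: s_def) (simp add: algebra_simps)
  then have s: "\<gamma> * u = u * s" by simp
  have "\<gamma>' * u = u * ((k' * a + c') *\<^sub>R 1 - s)"
    by (simp add: loop'[OF u(1)] s right_diff_distrib)
  with s u show ?thesis unfolding T_def S_def by blast
qed


text \<open>Words in \<open>Q * Y\<close> and \<open>R * Y\<close> of length at most two, applied to
  \<open>u\<close>, span an invariant subspace: a further \<open>Y\<close> either returns to
  \<open>P\<close>, where loops act on \<open>u\<close> by scalars, or makes a loop at
  \<open>Q\<close> or \<open>R\<close> that \<open>quadratic_loop\<close> shortens.\<close>

lemma reducible_pencil:
  "\<exists>U r. U * adj U = 1 \<and> adj U * U = 1 \<and> 0 < r \<and> r < 6 \<and>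
    (\<forall>i<6. \<forall>j<6. (i < r) \<noteq> (j < r) \<longrightarrow> ent (U * X * adj U) i j = 0 \<and> ent (U * Y * adj U) i j = 0)"
proof -
  interpret Q: cubic_pencil X Y Q P R q p r b1 b2 b3 c2 c3 d3
    using cubic_pencil_axioms by (rule cubic_pencil_permute)
  interpret R: cubic_pencil X Y R Q P r q p b1 b2 b3 c2 c3 d3
    using cubic_pencil_axioms by (rule cubic_pencil_permute)
  obtain u a s s' where u: "u \<noteq> 0" "P * u = u" "u * e0 = u"
    and \<alpha>u: "P * Y * Q * Y * P * u = a *\<^sub>R u"
    and \<gamma>u: "P * Y * Q * Y * R * Y * P * u = u * s"
    and \<gamma>'u: "P * Y * R * Y * Q * Y * P * u = u * s'"
    using common_eigenvector by blast
  have loops: "P * (Y * (Q * (Y * u))) = a *\<^sub>R u" "P * (Y * (Q * (Y * (R * (Y * u))))) = u * s"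
    "P * (Y * (R * (Y * (Q * (Y * u))))) = u * s'"
    using \<alpha>u \<gamma>u \<gamma>'u by (simp_all add: mult.assoc u)
  obtain b where \<beta>u: "P * (Y * (R * (Y * u))) = b *\<^sub>R u"
  proof -
    obtain t where "(p - r) *\<^sub>R (P * Y * Q * Y * P) + (p - q) *\<^sub>R (P * Y * R * Y * P) = t *\<^sub>R P"
      using quadratic_loop by blast
    then have "((p - r) *\<^sub>R (P * Y * Q * Y * P) + (p - q) *\<^sub>R (P * Y * R * Y * P)) * u = t *\<^sub>R P * u" by simp
    then have "(p - r) *\<^sub>R (a *\<^sub>R u) + (p - q) *\<^sub>R (P * (Y * (R * (Y * u)))) = t *\<^sub>R u"
      by (simp only: distrib_right mult_scaleR_left mult.assoc u loops)
    then have "(p - q) *\<^sub>R (P * (Y * (R * (Y * u)))) = t *\<^sub>R u - (p - r) *\<^sub>R (a *\<^sub>R u)"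
      by (simp only: eq_diff_eq add.commute)
    also have "\<dots> = (t - (p - r) * a) *\<^sub>R u" by (simp only: scaleR_scaleR scaleR_diff_left)
    finally have "(p - q) *\<^sub>R (P * (Y * (R * (Y * u)))) = (t - (p - r) * a) *\<^sub>R u" .
    from scaleR_eq_imp_multiple[OF this] ne show ?thesis using that by auto
  qed
  obtain mp where mp: "P * (Y * (P * x)) = mp *\<^sub>R (P * x)" for x
    using diagonal_block by (metis mult.assoc mult_scaleR_left)
  obtain mq where mq: "Q * (Y * (Q * x)) = mq *\<^sub>R (Q * x)" for x
    using Q.diagonal_block by (metis mult.assoc mult_scaleR_left)
  obtain mr where mr: "R * (Y * (R * x)) = mr *\<^sub>R (R * x)" for x
    using R.diagonal_block by (metis mult.assoc mult_scaleR_left)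
  \<comment> \<open>\<open>quadratic_loop\<close> based at \<open>Q\<close> trades the detour
    through \<open>R\<close> for one through \<open>P\<close>; \<open>RQR\<close> below does the
    same at \<open>R\<close>.\<close>
  obtain k c where QRQ: "Q * (Y * (R * (Y * (Q * x)))) = k *\<^sub>R (Q * (Y * (P * (Y * (Q * x))))) + c *\<^sub>R (Q * x)" for x
  proof -
    obtain t where t: "(q - r) *\<^sub>R (Q * Y * P * Y * Q) + (q - p) *\<^sub>R (Q * Y * R * Y * Q) = t *\<^sub>R Q"
      using Q.quadratic_loop by blast
    have "(q - p) *\<^sub>R (Q * Y * R * Y * Q) = 1 *\<^sub>R (t *\<^sub>R Q - (q - r) *\<^sub>R (Q * Y * P * Y * Q))"
      using t by (simp add: algebra_simps)
    from scaleR_eq_imp_multiple[OF this] ne obtain k c where "Q * Y * R * Y * Q = c *\<^sub>R Q - k *\<^sub>R (Q * Y * P * Y * Q)"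
      by (auto simp: scaleR_diff_right)
    then have "Q * Y * R * Y * Q * x = (c *\<^sub>R Q - k *\<^sub>R (Q * Y * P * Y * Q)) * x" for x by simp
    then have "Q * (Y * (R * (Y * (Q * x)))) = (- k) *\<^sub>R (Q * (Y * (P * (Y * (Q * x))))) + c *\<^sub>R (Q * x)" for x
      by (simp add: left_diff_distrib mult.assoc)
    then show ?thesis by (rule that)
  qed
  obtain k' c' where RQR: "R * (Y * (Q * (Y * (R * x)))) = k' *\<^sub>R (R * (Y * (P * (Y * (R * x))))) + c' *\<^sub>R (R * x)" for x
  proof -
    obtain t where t: "(r - p) *\<^sub>R (R * Y * Q * Y * R) + (r - q) *\<^sub>R (R * Y * P * Y * R) = t *\<^sub>R R"
      using R.quadratic_loop by blast
    have "(r - p) *\<^sub>R (R * Y * Q * Y * R) = 1 *\<^sub>R (t *\<^sub>R R - (r - q) *\<^sub>R (R * Y * P * Y * R))"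
      using t by (simp add: algebra_simps)
    from scaleR_eq_imp_multiple[OF this] ne obtain k c where "R * Y * Q * Y * R = c *\<^sub>R R - k *\<^sub>R (R * Y * P * Y * R)"
      by (auto simp: scaleR_diff_right)
    then have "R * Y * Q * Y * R * x = (c *\<^sub>R R - k *\<^sub>R (R * Y * P * Y * R)) * x" for x by simp
    then have "R * (Y * (Q * (Y * (R * x)))) = (- k) *\<^sub>R (R * (Y * (P * (Y * (R * x))))) + c *\<^sub>R (R * x)" for x
      by (simp add: left_diff_distrib mult.assoc)
    then show ?thesis by (rule that)
  qed
  have split: "y = P * y + Q * y + R * y" for y
    using mult_split[of 1 y] by simp
  define m2 where "m2 = Q * (Y * u)"
  define m3 where "m3 = R * (Y * u)"
  define m4 where "m4 = Q * (Y * m3)"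
  define m5 where "m5 = R * (Y * m2)"
  have Yu: "Y * u = mp *\<^sub>R u + m2 + m3"
    using split[of "Y * u"] mp[of u] by (simp add: u m2_def m3_def)
  have Ym2: "Y * m2 = a *\<^sub>R u + mq *\<^sub>R m2 + m5"
    using split[of "Y * m2"] by (simp add: m5_def m2_def loops mq)
  have Ym3: "Y * m3 = b *\<^sub>R u + m4 + mr *\<^sub>R m3"
    using split[of "Y * m3"] by (simp add: m4_def m3_def \<beta>u mr)
  have Ym4: "Y * m4 = u * s + mq *\<^sub>R m4 + (k' * b + c') *\<^sub>R m3"
    using split[of "Y * m4"] by (simp add: m4_def m3_def loops \<beta>u mq RQR scaleR_add_left)
  have Ym5: "Y * m5 = u * s' + (k * a + c) *\<^sub>R m2 + mr *\<^sub>R m5"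
    using split[of "Y * m5"] by (simp add: m5_def m2_def loops mr QRQ scaleR_add_left)
  have Xm: "X * u = p *\<^sub>R u" "X * m2 = q *\<^sub>R m2" "X * m3 = r *\<^sub>R m3" "X * m4 = q *\<^sub>R m4" "X * m5 = r *\<^sub>R m5"
    using XP Q.XP R.XP by (metis mult.assoc mult_scaleR_left u(2), simp_all add: m2_def m3_def m4_def m5_def mult.assoc[symmetric])
  \<comment> \<open>The columns of \<open>ms\<close> span an invariant subspace whose image under \<open>P\<close> is the line spanned by \<open>u\<close>,
    and \<open>P\<close> has rank two; the kernel of \<open>N\<close> is the orthogonal complement.\<close>
  define ms where "ms = [u, m2, m3, m4, m5]"
  define N where "N = (\<Sum>m\<leftarrow>ms. m * adj m)"
  have N0: "N * x = 0 \<longleftrightarrow> (\<forall>m\<in>set ms. adj m * x = 0)" for x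
  proof
    assume "N * x = 0"
    then have "adj x * (N * x) = 0" by simp
    \<comment> \<open>The form \<open>adj x * N * x\<close> is a sum of squares, so each
      \<open>adj m * x\<close> vanishes.\<close>
    then have "(\<Sum>z\<leftarrow>map (\<lambda>m. adj m * x) ms. adj z * z) = 0"
      by (simp add: N_def ms_def algebra_simps)
    from sum_adj_mult_self_eq_0[OF this] show "\<forall>m\<in>set ms. adj m * x = 0" by auto
  qed (simp add: N_def ms_def distrib_right mult.assoc)
  \<comment> \<open>For Hermitian \<open>Z\<close>, \<open>adj m * (Z * x)\<close> equals
    \<open>adj (Z * m) * x\<close>, so invariance of the span passes to its orthogonal
    complement.\<close>
  have inv: "N * (Z * x) = 0" if "N * x = 0" "adj Z = Z" "\<And>m. m \<in> set ms \<Longrightarrow> adj (Z * m) * x = 0" for Z x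
    unfolding N0 using that by (simp add: mult.assoc)
  have adj0: "adj u * x = 0" "adj m2 * x = 0" "adj m3 * x = 0" "adj m4 * x = 0" "adj m5 * x = 0" if "N * x = 0" for x
    using that unfolding N0 by (simp_all add: ms_def)
  have invX: "N * (X * x) = 0" if "N * x = 0" for x
    by (rule inv[OF that herm(1)]) (auto simp: ms_def Xm adj0[OF that] simp del: adj_mult)
  have invY: "N * (Y * x) = 0" if "N * x = 0" for x
    by (rule inv[OF that herm(2)])
      (auto simp: ms_def Yu Ym2 Ym3 Ym4 Ym5 adj_mult[of u] adj0[OF that] distrib_right mult.assoc simp del: adj_mult)
  define d where "d = (\<Sum>k<6. (cmod (ent u k 0))\<^sup>2)"
  have u_ent: "ent u i j = 0" if "i < 6" "0 < j" "j < 6" for i j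
    using arg_cong[OF u(3), of "\<lambda>A. ent A i j"] that by (simp add: e0_def)
  have uu: "adj u * u = d *\<^sub>R e0"
    by (rule mat6_eqI)
      (auto simp: ent_mult u_ent e0_def d_def complex_norm_square mult.commute neq0_conv simp del: of_real_power)
  have d: "d \<noteq> 0"
    using uu adj_mult_self_eq_0[of u] u(1) by auto
  \<comment> \<open>The projection onto the complement of \<open>u\<close> within the range of
    \<open>P\<close>. Its columns are also orthogonal to \<open>m2\<close>, ..., \<open>m5\<close>,
    which lie in the ranges of \<open>Q\<close> and \<open>R\<close>.\<close>
  define w where "w = P - (1 / d) *\<^sub>R (u * adj u)"
  have adj_u: "e0 * adj u = adj u" "adj u * P = adj u"
    using arg_cong[OF u(3), of adj] arg_cong[OF u(2), of adj] by (simp_all add: e0_def herm)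
  have "adj u * w = 0"
    using d by (simp add: w_def right_diff_distrib adj_u) (simp add: mult.assoc[symmetric] uu adj_u)
  moreover have Pw: "P * w = w" using u(2) idem by (simp add: w_def right_diff_distrib mult.assoc[symmetric])
  moreover have "Q * w = 0" "R * w = 0" by (subst Pw[symmetric], simp add: idem')+
  ultimately have "N * w = 0"
    unfolding N0 by (simp add: ms_def m2_def m3_def m4_def m5_def herm mult.assoc)
  moreover have "w \<noteq> 0"
  proof
    assume "w = 0"
    then have "P = (1 / d) *\<^sub>R (u * adj u)" by (simp add: w_def)
    \<comment> \<open>Then \<open>P\<close> would have rank one, against its leading two by two
      block being the identity.\<close>
    then have "ent P i j = ent u i 0 * cnj (ent u j 0) / d" if "i < 6" "j < 6" for i j
      using that by (simp add: ent_mult lessThan_Suc_eq_insert_0 numeral_eq_Suc u_ent)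
    from this[of 0 0] this[of 0 1] this[of 1 1] show False
      by (auto simp: P_diag)
  qed
  moreover have "adj N = N" by (simp add: N_def ms_def)
  moreover have "N \<noteq> 0"
  proof
    assume "N = 0"
    then have "N * u = 0" by simp
    then show False using adj0(1) adj_mult_self_eq_0 u(1) by blast
  qed
  ultimately show ?thesis
    using invX invY herm(1,2) by (intro invariant_split) auto
qed

end

section \<open>Real-rooted and ternary cubics\<close>

lemma nonneg_at_right_0:
  fixes f :: "real \<Rightarrow> real"
  assumes "isCont f 0" "\<And>y. y > 0 \<Longrightarrow> f y \<ge> 0"
  shows "f 0 \<ge> 0"
proof (rule tendsto_lowerbound)
  show "(f \<longlongrightarrow> f 0) (at_right 0)"
    using assms(1) unfolding isCont_def by (rule filterlim_at_split[THEN iffD1, THEN conjunct2])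
  show "\<forall>\<^sub>F y in at_right 0. 0 \<le> f y"
    using eventually_at_right_less by (rule eventually_mono) (rule assms(2))
qed simp

text \<open>
  The discriminant of a real-rooted cubic is nonnegative. At \<open>y = 0\<close> it vanishes with leading term \<open>- 4 p0\<^sup>3 r1 y\<close>,
  and with leading term \<open>- 27 r1\<^sup>2 y\<^sup>2\<close> if \<open>p0 = 0\<close>.
\<close>

lemma real_rooted_double_root:
  fixes p0 p1 q1 q2 r1 r2 r3 :: real
  assumes "\<And>y. \<exists>u v w. p0 + p1 * y = - (u + v + w) \<and> q1 * y + q2 * y\<^sup>2 = u * v + u * w + v * w
    \<and> r1 * y + r2 * y\<^sup>2 + r3 * y ^ 3 = - (u * v * w)"
  shows "r1 = 0"
proof -
  define p where "p y = p0 + p1 * y" for y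
  define q where "q y = q1 + q2 * y" for y
  define r where "r y = r1 + r2 * y + r3 * y\<^sup>2" for y
  \<comment> \<open>The left-hand side is the discriminant, the square of the product of the root
    differences.\<close>
  have disc: "(p y)\<^sup>2 * (y * q y)\<^sup>2 - 4 * (y * q y) ^ 3 - 4 * (p y) ^ 3 * (y * r y)
     + 18 * p y * (y * q y) * (y * r y) - 27 * (y * r y)\<^sup>2 \<ge> 0" for y
  proof -
    obtain u v w where "p y = - (u + v + w)" "y * q y = u * v + u * w + v * w" "y * r y = - (u * v * w)"
      using assms[of y] by (auto simp: p_def q_def r_def algebra_simps power2_eq_square power3_eq_cube)
    then have "(p y)\<^sup>2 * (y * q y)\<^sup>2 - 4 * (y * q y) ^ 3 - 4 * (p y) ^ 3 * (y * r y)
      + 18 * p y * (y * q y) * (y * r y) - 27 * (y * r y)\<^sup>2 = ((u - v) * (u - w) * (v - w))\<^sup>2"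
      by (simp only:) (simp add: algebra_simps power2_eq_square power3_eq_cube)
    then show ?thesis by simp
  qed
  define E where "E y = (p y)\<^sup>2 * y * (q y)\<^sup>2 - 4 * y\<^sup>2 * (q y) ^ 3 - 4 * (p y) ^ 3 * r y
     + 18 * p y * y * q y * r y - 27 * y * (r y)\<^sup>2" for y
  have E: "y * E y \<ge> 0" for y
    using disc[of y] by (simp add: E_def algebra_simps power2_eq_square power3_eq_cube)
  have cont: "isCont E y" for y unfolding E_def p_def q_def r_def by (intro continuous_intros)
  have "E y \<ge> 0" if "y > 0" for y using E[of y] that by (simp add: zero_le_mult_iff)
  with cont have "E 0 \<ge> 0" by (rule nonneg_at_right_0)
  \<comment> \<open>\<open>y * E y\<close> is the discriminant, so \<open>E\<close> changes sign at
    0 in the weak sense; by continuity \<open>E 0 = 0\<close>.\<close>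
  moreover have "- E (- y) \<ge> 0" if "y > 0" for y using E[of "- y"] that by (simp add: mult_le_0_iff)
  moreover have "isCont (\<lambda>y. - E (- y)) 0"
    unfolding E_def p_def q_def r_def by (intro continuous_intros)
  ultimately have "E 0 \<ge> 0" "- E (- 0) \<ge> 0"
    using nonneg_at_right_0[of "\<lambda>y. - E (- y)"] by blast+
  then have "E 0 = 0" by simp
  then have "p0 ^ 3 * r1 = 0" by (simp add: E_def p_def r_def)
  then consider "r1 = 0" | "p0 = 0" by auto
  then show ?thesis
  proof cases
    case 2
    define E2 where "E2 y = p1\<^sup>2 * y\<^sup>2 * (q y)\<^sup>2 - 4 * y * (q y) ^ 3 - 4 * p1 ^ 3 * y\<^sup>2 * r y
      + 18 * p1 * y * q y * r y - 27 * (r y)\<^sup>2" for y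
    have E2: "y\<^sup>2 * E2 y \<ge> 0" for y
      using disc[of y] 2 by (simp add: E2_def p_def algebra_simps power2_eq_square power3_eq_cube)
    have "E2 y \<ge> 0" if "y > 0" for y using E2[of y] that by (simp add: zero_le_mult_iff)
    moreover have "isCont E2 0"
      unfolding E2_def q_def r_def by (intro continuous_intros)
    ultimately have "E2 0 \<ge> 0" using nonneg_at_right_0[of E2] by blast
    then show ?thesis by (simp add: E2_def r_def)
  qed
qed

section \<open>Ternary cubics monic in \<open>z\<close>, and lines contained in them\<close>

locale monic_ternary_cubic =
  fixes a1 b1 a2 b2 c2 a3 b3 c3 d3 :: complex
begin

definition "G x y z = z ^ 3 + (a1 * x + b1 * y) * z\<^sup>2 + (a2 * x\<^sup>2 + b2 * x * y + c2 * y\<^sup>2) * z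
  + (a3 * x ^ 3 + b3 * x\<^sup>2 * y + c3 * x * y\<^sup>2 + d3 * y ^ 3)"
definition "Gx x y z = a1 * z\<^sup>2 + (2 * a2 * x + b2 * y) * z + (3 * a3 * x\<^sup>2 + 2 * b3 * x * y + c3 * y\<^sup>2)"
definition "Gy x y z = b1 * z\<^sup>2 + (b2 * x + 2 * c2 * y) * z + (b3 * x\<^sup>2 + 2 * c3 * x * y + 3 * d3 * y\<^sup>2)"
definition "Gz x y z = 3 * z\<^sup>2 + 2 * (a1 * x + b1 * y) * z + (a2 * x\<^sup>2 + b2 * x * y + c2 * y\<^sup>2)"

text \<open>The restriction of \<open>G\<close> to the line \<open>z = l x + m y\<close>, in the affine chart \<open>x = 1\<close>.\<close>

definition "on_line l m = [: l ^ 3 + a1 * l\<^sup>2 + a2 * l + a3,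
  3 * l\<^sup>2 * m + 2 * a1 * l * m + b1 * l\<^sup>2 + a2 * m + b2 * l + b3,
  3 * l * m\<^sup>2 + a1 * m\<^sup>2 + 2 * b1 * l * m + b2 * m + c2 * l + c3,
  m ^ 3 + b1 * m\<^sup>2 + c2 * m + d3 :]"

lemma poly_on_line: "poly (on_line l m) t = G 1 t (l + m * t)"
  unfolding on_line_def G_def by (simp add: power2_eq_square power3_eq_cube algebra_simps)

text \<open>A cubic containing a line is that line times a conic and is singular where the two meet.
  On the line the conic is \<open>Gz\<close>, a binary quadratic form, which has a nontrivial
  complex zero.\<close>

lemma line_imp_singular:
  assumes "on_line l m = 0"
  shows "\<exists>x y z. (x, y, z) \<noteq> (0, 0, 0) \<and> G x y z = 0 \<and> Gx x y z = 0 \<and> Gy x y z = 0 \<and> Gz x y z = 0"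
proof -
  define k0 where "k0 = l ^ 3 + a1 * l\<^sup>2 + a2 * l + a3"
  define k1 where "k1 = 3 * l\<^sup>2 * m + 2 * a1 * l * m + b1 * l\<^sup>2 + a2 * m + b2 * l + b3"
  define k2 where "k2 = 3 * l * m\<^sup>2 + a1 * m\<^sup>2 + 2 * b1 * l * m + b2 * m + c2 * l + c3"
  define k3 where "k3 = m ^ 3 + b1 * m\<^sup>2 + c2 * m + d3"
  note k_defs = k0_def k1_def k2_def k3_def
  have k: "k0 = 0" "k1 = 0" "k2 = 0" "k3 = 0"
    using assms by (auto simp: on_line_def k_defs)
  define A where "A = 3 * l\<^sup>2 + 2 * a1 * l + a2"
  define B where "B = 6 * l * m + 2 * a1 * m + 2 * b1 * l + b2"
  define C where "C = 3 * m\<^sup>2 + 2 * b1 * m + c2"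
  have Gz: "Gz x y (l * x + m * y) = A * x\<^sup>2 + B * x * y + C * y\<^sup>2" for x y
    by (simp add: Gz_def A_def B_def C_def algebra_simps power2_eq_square)
  obtain x y where xy: "(x, y) \<noteq> (0, 0)" "A * x\<^sup>2 + B * x * y + C * y\<^sup>2 = 0"
  proof (cases "A = 0")
    case True
    then show ?thesis using that[of 1 0] by simp
  next
    case False
    define s where "s = csqrt (B\<^sup>2 - 4 * A * C)"
    have s: "s\<^sup>2 = B\<^sup>2 - 4 * A * C" by (simp add: s_def)
    define x where "x = (s - B) / (2 * A)"
    have x: "2 * A * x = s - B" using False by (simp add: x_def)
    have "4 * A * (A * x\<^sup>2 + B * x * 1 + C * 1\<^sup>2) = (2 * A * x + B)\<^sup>2 - (B\<^sup>2 - 4 * A * C)"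
      by (simp add: algebra_simps power2_eq_square)
    also have "\<dots> = 0" by (simp add: x s)
    finally have "4 * A * (A * x\<^sup>2 + B * x * 1 + C * 1\<^sup>2) = 0" .
    then show ?thesis using that[of x 1] False by simp
  qed
  define z where "z = l * x + m * y"
  have z: "Gz x y z = 0" using Gz xy by (simp add: z_def)
  \<comment> \<open>Chain rule: these combinations are the partial derivatives of the restriction of
    \<open>G\<close> to the line, which is zero.\<close>
  moreover have "Gx x y z + l * Gz x y z = 3 * k0 * x\<^sup>2 + 2 * k1 * x * y + k2 * y\<^sup>2"
    by (simp add: z_def Gx_def Gz_def k_defs algebra_simps power2_eq_square power3_eq_cube)
  moreover have "Gy x y z + m * Gz x y z = k1 * x\<^sup>2 + 2 * k2 * x * y + 3 * k3 * y\<^sup>2"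
    by (simp add: z_def Gy_def Gz_def k_defs algebra_simps power2_eq_square power3_eq_cube)
  moreover have "G x y z = k0 * x ^ 3 + k1 * x\<^sup>2 * y + k2 * x * y\<^sup>2 + k3 * y ^ 3"
    by (simp add: z_def G_def k_defs algebra_simps power2_eq_square power3_eq_cube)
  ultimately show ?thesis using xy k by (intro exI[of _ x] exI[of _ y] exI[of _ z]) auto
qed

lemma third_root:
  assumes "u \<noteq> v" "G x y u = 0" "G x y v = 0"
  shows "G x y (- (a1 * x + b1 * y) - u - v) = 0"
proof -
  define p where "p = a1 * x + b1 * y"
  define q where "q = a2 * x\<^sup>2 + b2 * x * y + c2 * y\<^sup>2"
  define r where "r = a3 * x ^ 3 + b3 * x\<^sup>2 * y + c3 * x * y\<^sup>2 + d3 * y ^ 3"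
  have G: "G x y z = z ^ 3 + p * z\<^sup>2 + q * z + r" for z by (simp add: G_def p_def q_def r_def)
  \<comment> \<open>The divided difference of the cubic at \<open>u\<close> and \<open>v\<close>; it
    vanishes when both are distinct roots.\<close>
  define d where "d = u\<^sup>2 + u * v + v\<^sup>2 + p * (u + v) + q"
  have "(u - v) * d = G x y u - G x y v"
    by (simp add: G d_def algebra_simps power2_eq_square power3_eq_cube)
  then have "d = 0" using assms by simp
  moreover have "G x y (- p - u - v) = G x y u + (- p - u - v - u) * d"
    by (simp add: G d_def algebra_simps power2_eq_square power3_eq_cube)
  ultimately show ?thesis using assms(2) by (simp add: p_def)
qed

text \<open>
  Here \<open>G\<close> vanishes on the zeros of the determinant of a \<open>2 \<times> 2\<close> pencil. For each \<open>t\<close> either the two zeros coincide and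
  half the trace is a root of \<open>G\<close>, or the third root of \<open>G\<close> is affine in \<open>t\<close>.
\<close>

lemma linear_factor_of_quadratic_factor:
  assumes "\<And>t z. (z - (e + f * t)) * (z - (g + h * t)) = (k + k' * t) * (n + n' * t) \<Longrightarrow> G 1 t z = 0"
  shows "\<exists>l m. on_line l m = 0"
proof -
  define l where "l = (e + g) / 2"
  define m where "m = (f + h) / 2"
  \<comment> \<open>The alternative depends on \<open>t\<close>, but the product of both candidates
    vanishes for every \<open>t\<close>, hence as a polynomial, and then one factor is zero. The
    second candidate is the third root given by the sum of the roots.\<close>
  have "poly (on_line l m * on_line (- a1 - 2 * l) (- b1 - 2 * m)) t = 0" for t
  proof -
    define \<tau> where "\<tau> = l + m * t"
    define \<delta> where "\<delta> = (e + f * t) * (g + h * t) - (k + k' * t) * (n + n' * t)"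
    define s where "s = csqrt (\<tau>\<^sup>2 - \<delta>)"
    have s: "s\<^sup>2 = \<tau>\<^sup>2 - \<delta>" by (simp add: s_def)
    have 2: "2 * \<tau> = e + f * t + (g + h * t)" by (simp add: \<tau>_def l_def m_def field_simps)
    have r: "(z - (e + f * t)) * (z - (g + h * t)) - (k + k' * t) * (n + n' * t) = z\<^sup>2 - (2 * \<tau>) * z + \<delta>" for z
      unfolding 2 \<delta>_def by (simp add: algebra_simps power2_eq_square)
    have "(\<tau> + s)\<^sup>2 - (2 * \<tau>) * (\<tau> + s) + \<delta> = 0" "(\<tau> - s)\<^sup>2 - (2 * \<tau>) * (\<tau> - s) + \<delta> = 0"
      using s by (simp_all add: algebra_simps power2_eq_square)
    then have *: "G 1 t (\<tau> + s) = 0" "G 1 t (\<tau> - s) = 0"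
      unfolding r[symmetric] by (auto intro!: assms)
    show ?thesis
    proof (cases "s = 0")
      case True
      then show ?thesis using * by (simp add: poly_on_line \<tau>_def)
    next
      case False
      then have "\<tau> + s \<noteq> \<tau> - s" by (simp add: eq_diff_eq)
      from third_root[OF this *] have "G 1 t (- a1 - 2 * l + (- b1 - 2 * m) * t) = 0"
        by (simp add: \<tau>_def algebra_simps)
      then show ?thesis by (simp add: poly_on_line)
    qed
  qed
  then have "on_line l m * on_line (- a1 - 2 * l) (- b1 - 2 * m) = 0"
    using poly_all_0_iff_0 by blast
  then show ?thesis by (metis mult_eq_0_iff)
qed

end

section \<open>Evaluation of ternary polynomials and their derivatives\<close>

definition monom3 :: "complex \<Rightarrow> complex \<Rightarrow> complex \<Rightarrow> nat \<times> nat \<times> nat \<Rightarrow> complex" where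
  "monom3 x y z = (\<lambda>(i, j, k). x ^ i * y ^ j * z ^ k)"

lemma eval3_monom3: "eval3 F x y z = (\<Sum>m\<in>Poly_Mapping.keys F. Poly_Mapping.lookup F m * monom3 x y z m)"
  unfolding eval3_def monom3_def by (intro sum.cong) (auto simp: mult.assoc)

lemma eval3_superset:
  assumes "finite A" "Poly_Mapping.keys F \<subseteq> A"
  shows "eval3 F x y z = (\<Sum>m\<in>A. Poly_Mapping.lookup F m * monom3 x y z m)"
  unfolding eval3_monom3 using assms by (intro sum.mono_neutral_left) (auto simp: in_keys_iff)

lemma eval3_add: "eval3 (F + F') x y z = eval3 F x y z + eval3 F' x y z"
proof -
  let ?A = "Poly_Mapping.keys F \<union> Poly_Mapping.keys F'"
  have "Poly_Mapping.keys (F + F') \<subseteq> ?A" by (rule keys_add)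
  then show ?thesis
    by (simp add: eval3_superset[of ?A] lookup_add distrib_right sum.distrib)
qed

lemma eval3_zero: "eval3 0 x y z = 0"
  by (simp add: eval3_monom3)

lemma eval3_sum: "eval3 (\<Sum>i\<in>A. f i) x y z = (\<Sum>i\<in>A. eval3 (f i) x y z)"
  by (induction A rule: infinite_finite_induct) (simp_all add: eval3_add eval3_zero)

lemma eval3_single: "eval3 (Poly_Mapping.single m c) x y z = c * monom3 x y z m"
  by (cases "c = 0") (simp_all add: eval3_zero eval3_monom3)

lemma eval3_cubic:
  assumes "homogeneous3 3 F"
  defines "c i j k \<equiv> Poly_Mapping.lookup F (i, j, k)"
  shows "eval3 F x y z = c 3 0 0 * x ^ 3 + c 2 1 0 * x\<^sup>2 * y + c 2 0 1 * x\<^sup>2 * z + c 1 2 0 * x * y\<^sup>2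
      + c 1 1 1 * x * y * z + c 1 0 2 * x * z\<^sup>2 + c 0 3 0 * y ^ 3 + c 0 2 1 * y\<^sup>2 * z + c 0 1 2 * y * z\<^sup>2
      + c 0 0 3 * z ^ 3" (is ?e)
    and "eval3 (partial_x F) x y z = 3 * c 3 0 0 * x\<^sup>2 + 2 * c 2 1 0 * x * y + 2 * c 2 0 1 * x * z
      + c 1 2 0 * y\<^sup>2 + c 1 1 1 * y * z + c 1 0 2 * z\<^sup>2" (is ?ex)
    and "eval3 (partial_y F) x y z = c 2 1 0 * x\<^sup>2 + 2 * c 1 2 0 * x * y + c 1 1 1 * x * z
      + 3 * c 0 3 0 * y\<^sup>2 + 2 * c 0 2 1 * y * z + c 0 1 2 * z\<^sup>2" (is ?ey)
    and "eval3 (partial_z F) x y z = c 2 0 1 * x\<^sup>2 + c 1 1 1 * x * y + 2 * c 1 0 2 * x * z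
      + c 0 2 1 * y\<^sup>2 + 2 * c 0 1 2 * y * z + 3 * c 0 0 3 * z\<^sup>2" (is ?ez)
proof -
  define A :: "(nat \<times> nat \<times> nat) set" where "A = {(3,0,0), (2,1,0), (2,0,1), (1,2,0), (1,1,1), (1,0,2), (0,3,0), (0,2,1), (0,1,2), (0,0,3)}"
  have "(i, j, k) \<in> A" if "i + j + k = 3" for i j k
  proof -
    have "i = 0 \<or> i = 1 \<or> i = 2 \<or> i = 3" "j = 0 \<or> j = 1 \<or> j = 2 \<or> j = 3" using that by linarith+
    moreover have "k = 3 - i - j" using that by simp
    ultimately show ?thesis using that by (elim disjE) (simp_all add: A_def)
  qed
  then have A: "Poly_Mapping.keys F \<subseteq> A" using assms(1) by (auto simp: homogeneous3_def)
  have fin: "finite A" by (simp add: A_def)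
  \<comment> \<open>The support is enlarged to all ten cubic monomials; the added ones have
    coefficient zero.\<close>
  have sup: "(\<Sum>m\<in>Poly_Mapping.keys F. g m * Poly_Mapping.lookup F m * h m) = (\<Sum>m\<in>A. g m * Poly_Mapping.lookup F m * h m)"
    for g h :: "nat \<times> nat \<times> nat \<Rightarrow> complex"
    using A fin by (intro sum.mono_neutral_left) (auto simp: in_keys_iff)
  show ?e
    unfolding eval3_superset[OF fin A] by (simp add: A_def monom3_def c_def algebra_simps)
  have "eval3 (partial_x F) x y z = (\<Sum>m\<in>Poly_Mapping.keys F. of_nat (fst m) * Poly_Mapping.lookup F m
      * (case m of (i, j, k) \<Rightarrow> monom3 x y z (i - 1, j, k)))"
    by (simp add: partial_x_def eval3_sum eval3_single case_prod_unfold)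
  then show ?ex unfolding sup by (simp add: A_def monom3_def c_def power2_eq_square algebra_simps)
  have "eval3 (partial_y F) x y z = (\<Sum>m\<in>Poly_Mapping.keys F. of_nat (fst (snd m)) * Poly_Mapping.lookup F m
      * (case m of (i, j, k) \<Rightarrow> monom3 x y z (i, j - 1, k)))"
    by (simp add: partial_y_def eval3_sum eval3_single case_prod_unfold)
  then show ?ey unfolding sup by (simp add: A_def monom3_def c_def power2_eq_square algebra_simps)
  have "eval3 (partial_z F) x y z = (\<Sum>m\<in>Poly_Mapping.keys F. of_nat (snd (snd m)) * Poly_Mapping.lookup F m
      * (case m of (i, j, k) \<Rightarrow> monom3 x y z (i, j, k - 1)))"
    by (simp add: partial_z_def eval3_sum eval3_single case_prod_unfold)
  then show ?ez unfolding sup by (simp add: A_def monom3_def c_def power2_eq_square algebra_simps)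
qed

context monic_ternary_cubic
begin

text \<open>The roots enter through their elementary symmetric functions, which counts
  multiplicities and gives direct access to the coefficients.\<close>

lemma splits: "\<exists>u v w. a1 * x + b1 * y = - (u + v + w) \<and> a2 * x\<^sup>2 + b2 * x * y + c2 * y\<^sup>2 = u * v + u * w + v * w
  \<and> a3 * x ^ 3 + b3 * x\<^sup>2 * y + c3 * x * y\<^sup>2 + d3 * y ^ 3 = - (u * v * w)"
proof -
  define g where "g = [: a3 * x ^ 3 + b3 * x\<^sup>2 * y + c3 * x * y\<^sup>2 + d3 * y ^ 3,
    a2 * x\<^sup>2 + b2 * x * y + c2 * y\<^sup>2, a1 * x + b1 * y, 1 :]"
  have deg: "degree g = 3" by (simp add: g_def)
  obtain as where as: "smult (coeff g (degree g)) (\<Prod>a\<leftarrow>as. [:- a, 1:]) = g" "length as = 3"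
    using fundamental_theorem_algebra_factorized[of g] deg by auto
  have "coeff g (degree g) = 1" unfolding deg by (simp add: g_def numeral_eq_Suc)
  moreover obtain u v w where "as = [u, v, w]"
    using as(2) by (auto simp: numeral_eq_Suc length_Suc_conv)
  ultimately have "g = [:- u, 1:] * ([:- v, 1:] * [:- w, 1:])" using as(1) by simp
  then have "a1 * x + b1 * y = - (u + v + w)" "a2 * x\<^sup>2 + b2 * x * y + c2 * y\<^sup>2 = u * v + u * w + v * w"
    "a3 * x ^ 3 + b3 * x\<^sup>2 * y + c3 * x * y\<^sup>2 + d3 * y ^ 3 = - (u * v * w)"
    by (simp_all add: g_def algebra_simps)
  then show ?thesis by blast
qed

lemma G_factored:
  assumes "a1 * x + b1 * y = - (u + v + w)" "a2 * x\<^sup>2 + b2 * x * y + c2 * y\<^sup>2 = u * v + u * w + v * w"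
    "a3 * x ^ 3 + b3 * x\<^sup>2 * y + c3 * x * y\<^sup>2 + d3 * y ^ 3 = - (u * v * w)"
  shows "G x y z = (z - u) * (z - v) * (z - w)"
  unfolding G_def assms by (simp add: algebra_simps power2_eq_square power3_eq_cube)

end

section \<open>Cubics hyperbolic with respect to \<open>(0, 0, 1)\<close>\<close>

locale hyperbolic_cubic = monic_ternary_cubic +
  assumes real_root: "\<And>x y z. G (complex_of_real x) (complex_of_real y) z = 0 \<Longrightarrow> z \<in> \<real>"
begin

lemma real_splits: "\<exists>u v w :: real. a1 * of_real x + b1 * of_real y = of_real (- (u + v + w))
  \<and> a2 * (of_real x)\<^sup>2 + b2 * of_real x * of_real y + c2 * (of_real y)\<^sup>2 = of_real (u * v + u * w + v * w)
  \<and> a3 * of_real x ^ 3 + b3 * (of_real x)\<^sup>2 * of_real y + c3 * of_real x * (of_real y)\<^sup>2 + d3 * of_real y ^ 3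
    = of_real (- (u * v * w))"
proof -
  obtain u v w where uvw: "a1 * of_real x + b1 * of_real y = - (u + v + w)"
    "a2 * (of_real x)\<^sup>2 + b2 * of_real x * of_real y + c2 * (of_real y)\<^sup>2 = u * v + u * w + v * w"
    "a3 * of_real x ^ 3 + b3 * (of_real x)\<^sup>2 * of_real y + c3 * of_real x * (of_real y)\<^sup>2 + d3 * of_real y ^ 3
    = - (u * v * w)"
    using splits by blast
  have "u \<in> \<real>" "v \<in> \<real>" "w \<in> \<real>"
    by (rule real_root[of x y], simp add: G_factored[OF uvw])+
  then show ?thesis using uvw by (elim Reals_cases) (intro exI conjI, simp_all)
qed

text \<open>The coefficients of powers of \<open>z\<close> are binary forms with real values at real
  points; their values at four points already force real coefficients.\<close>

lemma real_coeffs: "a1 \<in> \<real>" "b1 \<in> \<real>" "a2 \<in> \<real>" "b2 \<in> \<real>" "c2 \<in> \<real>" "a3 \<in> \<real>" "b3 \<in> \<real>" "c3 \<in> \<real>" "d3 \<in> \<real>"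
proof -
  have e: "a1 * of_real x + b1 * of_real y \<in> \<real>"
    "a2 * (of_real x)\<^sup>2 + b2 * of_real x * of_real y + c2 * (of_real y)\<^sup>2 \<in> \<real>"
    "a3 * of_real x ^ 3 + b3 * (of_real x)\<^sup>2 * of_real y + c3 * of_real x * (of_real y)\<^sup>2 + d3 * of_real y ^ 3 \<in> \<real>"
    for x y
    using real_splits[of x y] by (auto simp del: of_real_minus of_real_add of_real_mult)
  show "a1 \<in> \<real>" "b1 \<in> \<real>" "a2 \<in> \<real>" "b2 \<in> \<real>" "c2 \<in> \<real>" "a3 \<in> \<real>"
    "b3 \<in> \<real>" "c3 \<in> \<real>" "d3 \<in> \<real>"
    using e[of 1 0] e[of 0 1] e[of 1 1] e[of 1 "- 1"] by (simp_all add: complex_is_Real_iff)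
qed

lemma Re_coeffs: "a1 = of_real (Re a1)" "b1 = of_real (Re b1)" "a2 = of_real (Re a2)" "b2 = of_real (Re b2)"
    "c2 = of_real (Re c2)" "a3 = of_real (Re a3)" "b3 = of_real (Re b3)" "c3 = of_real (Re c3)" "d3 = of_real (Re d3)"
  using real_coeffs by (simp_all add: of_real_Re)

lemma Re_splits: "\<exists>u v w :: real. Re a1 * x + Re b1 * y = - (u + v + w)
  \<and> Re a2 * x\<^sup>2 + Re b2 * x * y + Re c2 * y\<^sup>2 = u * v + u * w + v * w
  \<and> Re a3 * x ^ 3 + Re b3 * x\<^sup>2 * y + Re c3 * x * y\<^sup>2 + Re d3 * y ^ 3 = - (u * v * w)"
proof -
  obtain u v w :: real where uvw: "a1 * of_real x + b1 * of_real y = of_real (- (u + v + w))"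
    "a2 * (of_real x)\<^sup>2 + b2 * of_real x * of_real y + c2 * (of_real y)\<^sup>2 = of_real (u * v + u * w + v * w)"
    "a3 * of_real x ^ 3 + b3 * (of_real x)\<^sup>2 * of_real y + c3 * of_real x * (of_real y)\<^sup>2 + d3 * of_real y ^ 3
    = of_real (- (u * v * w))"
    using real_splits[of x y] by blast
  show ?thesis
    using uvw[THEN arg_cong, of Re] by (intro exI[of _ u] exI[of _ v] exI[of _ w])
      (simp flip: of_real_power of_real_mult)
qed

text \<open>Translating \<open>z\<close> by \<open>h\<close> moves the double root to 0, where
  \<open>real_rooted_double_root\<close> says that the derivative in \<open>y\<close> vanishes.
  \<open>G\<close> and \<open>Gz\<close> vanish at a double root, and then \<open>Gx\<close>
  vanishes by Euler's relation.\<close>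

lemma double_root_imp_singular:
  assumes h: "Re a1 = - (h + h + w)" "Re a2 = h * h + h * w + h * w" "Re a3 = - (h * h * w)"
  shows "G 1 0 (of_real h) = 0 \<and> Gx 1 0 (of_real h) = 0 \<and> Gy 1 0 (of_real h) = 0 \<and> Gz 1 0 (of_real h) = 0"
proof -
  have r: "Re b1 * h\<^sup>2 + Re b2 * h + Re b3 = 0"
  proof (rule real_rooted_double_root)
    fix y :: real
    obtain u v w' where uvw: "Re a1 + Re b1 * y = - (u + v + w')"
      "Re a2 + Re b2 * y + Re c2 * y\<^sup>2 = u * v + u * w' + v * w'"
      "Re a3 + Re b3 * y + Re c3 * y\<^sup>2 + Re d3 * y ^ 3 = - (u * v * w')"
      using Re_splits[of 1 y] by auto
    have b: "Re b1 * y = - (u + v + w') - Re a1"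
      "Re b2 * y + Re c2 * y\<^sup>2 = u * v + u * w' + v * w' - Re a2"
      "Re b3 * y + Re c3 * y\<^sup>2 + Re d3 * y ^ 3 = - (u * v * w') - Re a3"
      using uvw by linarith+
    \<comment> \<open>Coefficients of the translated cubic, as symmetric functions of the translated
      roots \<open>u - h\<close>, \<open>v - h\<close>, \<open>w' - h\<close>.\<close>
    have "(3 * h + Re a1) + Re b1 * y = - ((u - h) + (v - h) + (w' - h))"
      unfolding b h by simp
    moreover have "(2 * h * Re b1 + Re b2) * y + Re c2 * y\<^sup>2 = (u - h) * (v - h) + (u - h) * (w' - h) + (v - h) * (w' - h)"
    proof -
      have "(2 * h * Re b1 + Re b2) * y + Re c2 * y\<^sup>2 = 2 * h * (Re b1 * y) + (Re b2 * y + Re c2 * y\<^sup>2)"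
        by (simp add: algebra_simps)
      also have "\<dots> = (u - h) * (v - h) + (u - h) * (w' - h) + (v - h) * (w' - h)"
        unfolding b h by (simp add: algebra_simps)
      finally show ?thesis .
    qed
    moreover have "(Re b1 * h\<^sup>2 + Re b2 * h + Re b3) * y + (Re c2 * h + Re c3) * y\<^sup>2 + Re d3 * y ^ 3
      = - ((u - h) * (v - h) * (w' - h))"
    proof -
      have "(Re b1 * h\<^sup>2 + Re b2 * h + Re b3) * y + (Re c2 * h + Re c3) * y\<^sup>2 + Re d3 * y ^ 3
        = h\<^sup>2 * (Re b1 * y) + h * (Re b2 * y + Re c2 * y\<^sup>2) + (Re b3 * y + Re c3 * y\<^sup>2 + Re d3 * y ^ 3)"
        by (simp add: algebra_simps)
      also have "\<dots> = - ((u - h) * (v - h) * (w' - h))"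
        unfolding b h by (simp add: algebra_simps power2_eq_square)
      finally show ?thesis .
    qed
    ultimately show "\<exists>u v w. (3 * h + Re a1) + Re b1 * y = - (u + v + w)
      \<and> (2 * h * Re b1 + Re b2) * y + Re c2 * y\<^sup>2 = u * v + u * w + v * w
      \<and> (Re b1 * h\<^sup>2 + Re b2 * h + Re b3) * y + (Re c2 * h + Re c3) * y\<^sup>2 + Re d3 * y ^ 3 = - (u * v * w)"
      by blast
  qed
  have a: "a1 = - (of_real h + of_real h + of_real w)" "a2 = of_real h * of_real h + of_real h * of_real w + of_real h * of_real w"
    "a3 = - (of_real h * of_real h * of_real w)"
    using h Re_coeffs by (metis of_real_add of_real_minus of_real_mult)+
  have "b1 * (of_real h)\<^sup>2 + b2 * of_real h + b3 = 0"
    by (subst Re_coeffs(2), subst Re_coeffs(4), subst Re_coeffs(7))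
      (use arg_cong[OF r, of complex_of_real] in simp)
  then have "Gy 1 0 (of_real h) = 0" by (simp add: Gy_def)
  moreover have "G 1 0 (of_real h) = 0" "Gx 1 0 (of_real h) = 0" "Gz 1 0 (of_real h) = 0"
    unfolding G_def Gx_def Gz_def by (simp_all add: a algebra_simps power2_eq_square power3_eq_cube)
  ultimately show ?thesis by blast
qed

end

text \<open>The identity is a binary cubic form in \<open>x\<close> and \<open>y\<close>. Its values
  at \<open>(1, 0)\<close> and \<open>(0, 1)\<close> are the extreme coefficients; those at
  \<open>(1, 1)\<close> and \<open>(1, -1)\<close> then separate the two middle ones.\<close>

lemma cubic_pencil_relations:
  fixes X Y :: "'a::real_algebra_1"
  assumes rel: "\<And>x y. let A = x *\<^sub>R X + y *\<^sub>R Y in A * A * A + (a1 * x + b1 * y) *\<^sub>R (A * A)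
      + (a2 * x\<^sup>2 + b2 * x * y + c2 * y\<^sup>2) *\<^sub>R A
      + (a3 * x ^ 3 + b3 * x\<^sup>2 * y + c3 * x * y\<^sup>2 + d3 * y ^ 3) *\<^sub>R 1 = 0"
  shows "X * X * Y + X * Y * X + Y * X * X + a1 *\<^sub>R (X * Y + Y * X) + b1 *\<^sub>R (X * X)
        + a2 *\<^sub>R Y + b2 *\<^sub>R X + b3 *\<^sub>R 1 = 0" (is "?R1 = 0")
    and "X * Y * Y + Y * X * Y + Y * Y * X + a1 *\<^sub>R (Y * Y) + b1 *\<^sub>R (X * Y + Y * X)
        + b2 *\<^sub>R Y + c2 *\<^sub>R X + c3 *\<^sub>R 1 = 0" (is "?R2 = 0")
    and "Y * Y * Y + b1 *\<^sub>R (Y * Y) + c2 *\<^sub>R Y + d3 *\<^sub>R 1 = 0" (is "?R3 = 0")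
proof -
  define R0 where "R0 = X * X * X + a1 *\<^sub>R (X * X) + a2 *\<^sub>R X + a3 *\<^sub>R 1"
  have R0: "R0 = 0" using rel[of 1 0] by (simp add: R0_def Let_def)
  show R3: "?R3 = 0" using rel[of 0 1] by (simp add: Let_def)
  have "R0 + ?R1 + ?R2 + ?R3 = 0"
    using rel[of 1 1] unfolding R0_def by (simp add: Let_def algebra_simps)
  then have 1: "?R1 + ?R2 = 0" unfolding R0 R3 by simp
  have "R0 - ?R1 + ?R2 - ?R3 = 0"
    using rel[of 1 "- 1"] unfolding R0_def by (simp add: Let_def algebra_simps)
  moreover have "v = u" if "0 - u + v - 0 = 0" for u v :: 'a
    using that by (simp add: add.commute)
  ultimately have 2: "?R2 = ?R1" unfolding R0 R3 by blast
  with 1 have "2 *\<^sub>R ?R1 = 0" by (simp only: scaleR_2)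
  then show "?R1 = 0" by simp
  with 2 show "?R2 = 0" by simp
qed

section \<open>Determinants of small and of block diagonal matrices\<close>

lemma det_2:
  fixes A :: "complex mat"
  assumes A: "A \<in> carrier_mat 2 2"
  shows "det A = A $$ (0, 0) * A $$ (1, 1) - A $$ (0, 1) * A $$ (1, 0)"
proof -
  have "det (mat_delete A 0 j) = A $$ (1, 1 - j)" if "j < 2" for j
  proof -
    have "mat_delete A 0 j \<in> carrier_mat 1 1" using mat_delete_carrier[OF A] by simp
    from det_single[OF this] show ?thesis using A that by (auto simp: mat_delete_def less_2_cases_iff)
  qed
  then show ?thesis using laplace_expansion_row[OF A, of 0]
    by (simp add: cofactor_def numeral_2_eq_2)
qed

lemma det_block_diagonal:
  fixes M :: "complex mat"
  assumes M: "M \<in> carrier_mat n n" and r: "r \<le> n"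
    and zero: "\<And>i j. i < n \<Longrightarrow> j < n \<Longrightarrow> (i < r) \<noteq> (j < r) \<Longrightarrow> M $$ (i, j) = 0"
  shows "det M = det (mat r r (\<lambda>(i, j). M $$ (i, j))) * det (mat (n - r) (n - r) (\<lambda>(i, j). M $$ (i + r, j + r)))"
proof -
  have "M = four_block_mat (mat r r (\<lambda>(i, j). M $$ (i, j))) (0\<^sub>m r (n - r)) (0\<^sub>m (n - r) r)
    (mat (n - r) (n - r) (\<lambda>(i, j). M $$ (i + r, j + r)))"
    using assms by (intro eq_matI) auto
  then show ?thesis by (metis det_four_block_mat_lower_left_zero mat_carrier zero_carrier_mat)
qed

section \<open>Block sizes and the theorem\<close>

lemma det_uminus_diff:
  fixes A B :: "complex mat"
  assumes "A \<in> carrier_mat 6 6" "B \<in> carrier_mat 6 6"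
  shows "det (A - B) = det (B - A)"
proof -
  have "A - B = (- 1) \<cdot>\<^sub>m (B - A)" using assms by (intro eq_matI) auto
  then show ?thesis using assms by (simp add: det_smult)
qed

text \<open>The situation of the theorem after \<open>F\<close> has been multiplied by a sign that
  makes it monic in \<open>z\<close>.\<close>

locale hermitian_double_cubic = monic_ternary_cubic a1 b1 a2 b2 c2 a3 b3 c3 d3
  for a1 b1 a2 b2 c2 a3 b3 c3 d3 +
  fixes X Y :: mat6
  assumes herm: "adj X = X" "adj Y = Y"
    and det: "\<And>x y z. det (x \<cdot>\<^sub>m to_mat X + y \<cdot>\<^sub>m to_mat Y - z \<cdot>\<^sub>m 1\<^sub>m 6) = (G x y z)\<^sup>2"
    and smooth: "\<And>x y z. (x, y, z) \<noteq> (0, 0, 0) \<Longrightarrow> G x y z = 0 \<Longrightarrow> Gx x y z \<noteq> 0 \<or> Gy x y z \<noteq> 0 \<or> Gz x y z \<noteq> 0"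
begin

lemma char_poly_pencil:
  "poly (char_poly (to_mat (x *\<^sub>R X + y *\<^sub>R Y))) z = (G (of_real x) (of_real y) z)\<^sup>2"
proof -
  have "to_mat (x *\<^sub>R X + y *\<^sub>R Y) = complex_of_real x \<cdot>\<^sub>m to_mat X + complex_of_real y \<cdot>\<^sub>m to_mat Y"
    by (simp add: plus_mat6.rep_eq scaleR_mat6.rep_eq)
  then show ?thesis
    by (simp add: poly_char_poly[of _ 6] det_uminus_diff[of "z \<cdot>\<^sub>m 1\<^sub>m 6"] flip: det)
qed

lemma adj_pencil: "adj (x *\<^sub>R X + y *\<^sub>R Y) = x *\<^sub>R X + y *\<^sub>R Y"
  by (simp add: herm)

sublocale hyperbolic_cubic
proof
  fix x y :: real and z assume "G (of_real x) (of_real y) z = 0"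
  then have root: "poly (char_poly (to_mat (x *\<^sub>R X + y *\<^sub>R Y))) z = 0" by (simp add: char_poly_pencil)
  obtain fs where fs: "char_poly (to_mat (x *\<^sub>R X + y *\<^sub>R Y)) = (\<Prod>e\<leftarrow>fs. [:- e, 1:])"
    using char_poly_factorized[of "to_mat (x *\<^sub>R X + y *\<^sub>R Y)" 6] by auto
  have "z \<in> set fs" using root unfolding fs by (auto simp: poly_prod_list prod_list_zero_iff)
  then show "z \<in> \<real>" using spectral_mat6[OF adj_pencil fs] by auto
qed

lemma no_line: "on_line l m \<noteq> 0"
  using line_imp_singular smooth by metis

text \<open>The characteristic polynomial is the square of the cubic, but a Hermitian matrix is
  diagonalizable, so the cubic itself annihilates it.\<close>

lemma pencil_relation:
  "let A = x *\<^sub>R X + y *\<^sub>R Y in A * A * A + (Re a1 * x + Re b1 * y) *\<^sub>R (A * A)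
      + (Re a2 * x\<^sup>2 + Re b2 * x * y + Re c2 * y\<^sup>2) *\<^sub>R A
      + (Re a3 * x ^ 3 + Re b3 * x\<^sup>2 * y + Re c3 * x * y\<^sup>2 + Re d3 * y ^ 3) *\<^sub>R 1 = 0"
proof -
  define A where "A = x *\<^sub>R X + y *\<^sub>R Y"
  obtain u v w where uvw: "Re a1 * x + Re b1 * y = - (u + v + w)"
    "Re a2 * x\<^sup>2 + Re b2 * x * y + Re c2 * y\<^sup>2 = u * v + u * w + v * w"
    "Re a3 * x ^ 3 + Re b3 * x\<^sup>2 * y + Re c3 * x * y\<^sup>2 + Re d3 * y ^ 3 = - (u * v * w)"
    using Re_splits by blast
  have G: "G (of_real x) (of_real y) z = (z - of_real u) * (z - of_real v) * (z - of_real w)" for z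
  proof (rule G_factored)
    show "a1 * of_real x + b1 * of_real y = - (complex_of_real u + of_real v + of_real w)"
      using arg_cong[OF uvw(1), of complex_of_real] by (simp flip: Re_coeffs)
    show "a2 * (of_real x)\<^sup>2 + b2 * of_real x * of_real y + c2 * (of_real y)\<^sup>2
        = of_real u * of_real v + of_real u * of_real w + complex_of_real v * of_real w"
      using arg_cong[OF uvw(2), of complex_of_real] by (simp flip: Re_coeffs)
    show "a3 * of_real x ^ 3 + b3 * (of_real x)\<^sup>2 * of_real y + c3 * of_real x * (of_real y)\<^sup>2 + d3 * of_real y ^ 3
        = - (of_real u * of_real v * complex_of_real w)"
      using arg_cong[OF uvw(3), of complex_of_real] by (simp flip: Re_coeffs)
  qed
  have "fold (\<lambda>e x. A * x - e *\<^sub>R x) [u, v, w] 1 = 0"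
    unfolding A_def by (rule hermitian_annihilated[OF adj_pencil]) (auto simp: char_poly_pencil G)
  then have "A * A * A - (u + v + w) *\<^sub>R (A * A) + (u * v + u * w + v * w) *\<^sub>R A - (u * v * w) *\<^sub>R 1 = 0"
    by (simp add: algebra_simps)
  then show ?thesis unfolding Let_def A_def[symmetric] uvw by (simp add: algebra_simps)
qed

lemma simple_spectrum: "\<exists>p q r. p \<noteq> q \<and> p \<noteq> r \<and> q \<noteq> r \<and> Re a1 = - (p + q + r) \<and> Re a2 = p * q + p * r + q * r
  \<and> Re a3 = - (p * q * r)"
proof -
  obtain p q r where pqr: "Re a1 = - (p + q + r)" "Re a2 = p * q + p * r + q * r" "Re a3 = - (p * q * r)"
    using Re_splits[of 1 0] by auto
  have "\<not> (Re a1 = - (h + h + w) \<and> Re a2 = h * h + h * w + h * w \<and> Re a3 = - (h * h * w))" for h w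
    using double_root_imp_singular[of h w] smooth[of 1 0 "of_real h"] by auto
  from this[of p r] this[of p q] this[of q p] pqr have "p \<noteq> q \<and> p \<noteq> r \<and> q \<noteq> r"
    by (auto simp: algebra_simps)
  with pqr show ?thesis by blast
qed

lemma reducible:
  "\<exists>U r. U * adj U = 1 \<and> adj U * U = 1 \<and> 0 < r \<and> r < 6 \<and>
    (\<forall>i<6. \<forall>j<6. (i < r) \<noteq> (j < r) \<longrightarrow> ent (U * X * adj U) i j = 0 \<and> ent (U * Y * adj U) i j = 0)"
proof -
  obtain p q r where ne: "p \<noteq> q" "p \<noteq> r" "q \<noteq> r" and pqr: "Re a1 = - (p + q + r)" "Re a2 = p * q + p * r + q * r"
    "Re a3 = - (p * q * r)" using simple_spectrum by blast
  \<comment> \<open>Equal eigenvalues are adjacent, which makes the spectral projections of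
    \<open>X'\<close> the coordinate projections \<open>P\<close>, \<open>Q\<close>,
    \<open>R\<close>.\<close>
  define es where "es = map complex_of_real [p, p, q, q, r, r]"
  have a: "a1 = - (of_real p + of_real q + of_real r)" "a2 = of_real p * of_real q + of_real p * of_real r + of_real q * of_real r"
    "a3 = - (of_real p * of_real q * of_real r)"
    using pqr Re_coeffs by (metis of_real_add of_real_minus of_real_mult)+
  have "char_poly (to_mat X) = (\<Prod>e\<leftarrow>es. [:- e, 1:])"
  proof (rule poly_ext)
    fix z
    have "poly (char_poly (to_mat X)) z = (G 1 0 z)\<^sup>2" using char_poly_pencil[of 1 0 z] by simp
    also have "G 1 0 z = (z - of_real p) * (z - of_real q) * (z - of_real r)"
      by (rule G_factored) (simp_all add: a)
    finally show "poly (char_poly (to_mat X)) z = poly (\<Prod>e\<leftarrow>es. [:- e, 1:]) z"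
      by (simp add: es_def power2_eq_square algebra_simps)
  qed
  from spectral_mat6[OF herm(1) this] obtain U where U: "U * adj U = 1" "adj U * U = 1"
    "U * X * adj U = dg (\<lambda>i. Re (es ! i))" by auto
  define X' where "X' = U * X * adj U"
  define Y' where "Y' = U * Y * adj U"
  define P where "P = dg (\<lambda>i. if i < 2 then 1 else 0)"
  define Q where "Q = dg (\<lambda>i. if 2 \<le> i \<and> i < 4 then 1 else 0)"
  define R where "R = dg (\<lambda>i. if 4 \<le> i then 1 else 0)"
  have conj: "U * (A * B) * adj U = (U * A * adj U) * (U * B * adj U)" for A B
  proof -
    have "(U * A * adj U) * (U * B * adj U) = U * A * (adj U * U) * B * adj U" by (simp only: mult.assoc)
    then show ?thesis by (simp add: U mult.assoc)
  qed
  have rel: "let A = x *\<^sub>R X' + y *\<^sub>R Y' in A * A * A + (Re a1 * x + Re b1 * y) *\<^sub>R (A * A)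
      + (Re a2 * x\<^sup>2 + Re b2 * x * y + Re c2 * y\<^sup>2) *\<^sub>R A
      + (Re a3 * x ^ 3 + Re b3 * x\<^sup>2 * y + Re c3 * x * y\<^sup>2 + Re d3 * y ^ 3) *\<^sub>R 1 = 0" for x y
  proof -
    define A where "A = x *\<^sub>R X + y *\<^sub>R Y"
    have A': "x *\<^sub>R X' + y *\<^sub>R Y' = U * A * adj U"
      by (simp add: A_def X'_def Y'_def distrib_left distrib_right)
    obtain k2 k1 k0 where k: "k2 = Re a1 * x + Re b1 * y" "k1 = Re a2 * x\<^sup>2 + Re b2 * x * y + Re c2 * y\<^sup>2"
      "k0 = Re a3 * x ^ 3 + Re b3 * x\<^sup>2 * y + Re c3 * x * y\<^sup>2 + Re d3 * y ^ 3" by blast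
    have "A * A * A + k2 *\<^sub>R (A * A) + k1 *\<^sub>R A + k0 *\<^sub>R 1 = 0"
      using pencil_relation[of x y] unfolding Let_def A_def[symmetric] k .
    then have "U * (A * A * A + k2 *\<^sub>R (A * A) + k1 *\<^sub>R A + k0 *\<^sub>R 1) * adj U = 0" by simp
    then have "U * (A * A * A) * adj U + k2 *\<^sub>R (U * (A * A) * adj U) + k1 *\<^sub>R (U * A * adj U) + k0 *\<^sub>R 1 = 0"
      by (simp add: distrib_left distrib_right U)
    then show ?thesis unfolding Let_def A' k[symmetric] conj .
  qed
  have less6: "i = 0 \<or> i = 1 \<or> i = 2 \<or> i = 3 \<or> i = 4 \<or> i = 5" if "i < 6" for i :: nat
    using that by linarith
  interpret hermitian_cubic_pencil X' Y' P Q R p q r "Re b1" "Re b2" "Re b3" "Re c2" "Re c3" "Re d3"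
  proof unfold_locales
    show "P * P = P" "Q * Q = Q" "R * R = R" "P * Q = 0" "P * R = 0" "Q * P = 0" "Q * R = 0" "R * P = 0" "R * Q = 0"
      unfolding P_def Q_def R_def dg_mult dg_const_0[symmetric] by (rule dg_cong; simp)+
    show "P + Q + R = 1" unfolding P_def Q_def R_def dg_add dg_const_1[symmetric] by (rule dg_cong) simp
    show "X' = p *\<^sub>R P + q *\<^sub>R Q + r *\<^sub>R R"
      unfolding X'_def U P_def Q_def R_def dg_add dg_scaleR
      by (rule dg_cong) (drule less6, auto simp: es_def)
    show "X' * X' * Y' + X' * Y' * X' + Y' * X' * X' - (p + q + r) *\<^sub>R (X' * Y' + Y' * X') + Re b1 *\<^sub>R (X' * X')
        + (p * q + p * r + q * r) *\<^sub>R Y' + Re b2 *\<^sub>R X' + Re b3 *\<^sub>R 1 = 0"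
      using cubic_pencil_relations(1)[OF rel] unfolding pqr by (simp only: scaleR_minus_left diff_conv_add_uminus)
    show "X' * Y' * Y' + Y' * X' * Y' + Y' * Y' * X' - (p + q + r) *\<^sub>R (Y' * Y') + Re b1 *\<^sub>R (X' * Y' + Y' * X')
        + Re b2 *\<^sub>R Y' + Re c2 *\<^sub>R X' + Re c3 *\<^sub>R 1 = 0"
      using cubic_pencil_relations(2)[OF rel] unfolding pqr by (simp only: scaleR_minus_left diff_conv_add_uminus)
    show "Y' * Y' * Y' + Re b1 *\<^sub>R (Y' * Y') + Re c2 *\<^sub>R Y' + Re d3 *\<^sub>R 1 = 0"
      using cubic_pencil_relations(3)[OF rel] .
    show "adj X' = X'" "adj Y' = Y'" by (simp_all add: X'_def Y'_def herm mult.assoc)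
  qed (use ne in \<open>simp_all add: P_def Q_def R_def\<close>)
  obtain V k where V: "V * adj V = 1" "adj V * V = 1" "0 < k" "k < 6"
    "\<forall>i<6. \<forall>j<6. (i < k) \<noteq> (j < k) \<longrightarrow> ent (V * X' * adj V) i j = 0 \<and> ent (V * Y' * adj V) i j = 0"
    using reducible_pencil by blast
  have VU: "V * X' * adj V = (V * U) * X * adj (V * U)" "V * Y' * adj V = (V * U) * Y * adj (V * U)"
    by (simp_all add: X'_def Y'_def mult.assoc)
  have "V * U * adj (V * U) = 1"
  proof -
    have "V * U * adj (V * U) = V * (U * adj U) * adj V" by (simp only: adj_mult mult.assoc)
    then show ?thesis by (simp add: U V)
  qed
  moreover have "adj (V * U) * (V * U) = 1"
  proof -
    have "adj (V * U) * (V * U) = adj U * (adj V * V) * U" by (simp only: adj_mult mult.assoc)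
    then show ?thesis by (simp add: U V)
  qed
  ultimately show ?thesis using V(3-5) unfolding VU by blast
qed


text \<open>If \<open>r\<close> is not 3, one block has size one or two. \<open>G\<close> vanishes
  wherever the determinant of that block does, so a block of size one gives a line at once and one
  of size two through \<open>linear_factor_of_quadratic_factor\<close>. Smoothness excludes
  lines.\<close>

lemma invariant_block_size:
  assumes U: "U * adj U = 1" "adj U * U = 1" and r: "0 < r" "r < 6"
    and zero: "\<forall>i<6. \<forall>j<6. (i < r) \<noteq> (j < r) \<longrightarrow> ent (U * X * adj U) i j = 0 \<and> ent (U * Y * adj U) i j = 0"
  shows "r = 3"
proof (rule ccontr)
  assume "r \<noteq> 3"
  define H where "H = to_mat (U * X * adj U)"
  define K where "K = to_mat (U * Y * adj U)"
  define M where "M t z = H + t \<cdot>\<^sub>m K - z \<cdot>\<^sub>m 1\<^sub>m 6" for t z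
  have HK: "H \<in> carrier_mat 6 6" "K \<in> carrier_mat 6 6" by (simp_all add: H_def K_def)
  have M: "M t z \<in> carrier_mat 6 6" for t z using HK by (simp add: M_def minus_carrier_mat)
  have Mij: "M t z $$ (i, j) = H $$ (i, j) + t * K $$ (i, j) - (if i = j then z else 0)" if "i < 6" "j < 6" for t z i j
    using that HK by (simp add: M_def)
  have detM: "det (M t z) = (G 1 t z)\<^sup>2" for t z
  \<comment> \<open>Unitary conjugation does not change the determinant of the pencil.\<close>
  proof -
    let ?U = "to_mat U" and ?V = "to_mat (adj U)" and ?N = "1 \<cdot>\<^sub>m to_mat X + t \<cdot>\<^sub>m to_mat Y - z \<cdot>\<^sub>m 1\<^sub>m 6"
    have UV: "?U * ?V = 1\<^sub>m 6" using arg_cong[OF U(1), of to_mat] by (simp add: times_mat6.rep_eq one_mat6.rep_eq)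
    have N: "?N \<in> carrier_mat 6 6" by (simp add: minus_carrier_mat)
    have one: "1 \<cdot>\<^sub>m A = A" for A :: "complex mat" by (rule eq_matI) auto
    have "?U * ?N * ?V = ?U * to_mat X * ?V + t \<cdot>\<^sub>m (?U * to_mat Y * ?V) - z \<cdot>\<^sub>m (?U * ?V)"
      by (simp add: mult_minus_distrib_mat[of _ 6 6 _ 6] mult_add_distrib_mat[of _ 6 6 _ 6]
        minus_mult_distrib_mat[of _ 6 6 _ _ 6] add_mult_distrib_mat[of _ 6 6 _ _ 6]
        mult_smult_distrib[of _ 6 6 _ 6] mult_smult_assoc_mat[of _ 6 6 _ 6] mult_carrier_mat[of _ 6 6 _ 6]
        right_mult_one_mat[of _ 6 6] one)
    then have "M t z = ?U * ?N * ?V"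
      by (simp add: M_def H_def K_def times_mat6.rep_eq UV)
    then have "det (M t z) = det ?U * det ?N * det ?V"
      using N by (simp add: det_mult[of _ 6] mult_carrier_mat[of _ 6 6 _ 6])
    also have "\<dots> = det (?U * ?V) * det ?N" by (simp add: det_mult[of _ 6])
    finally show ?thesis by (simp add: UV det)
  qed
  define A where "A t z = mat r r (\<lambda>(i, j). M t z $$ (i, j))" for t z
  define B where "B t z = mat (6 - r) (6 - r) (\<lambda>(i, j). M t z $$ (i + r, j + r))" for t z
  have "det (M t z) = det (A t z) * det (B t z)" for t z
    unfolding A_def B_def
  proof (rule det_block_diagonal[OF M])
    fix i j assume "i < 6" "j < 6" "(i < r) \<noteq> (j < r)"
    then show "M t z $$ (i, j) = 0" using zero by (auto simp: Mij H_def K_def ent.rep_eq)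
  qed (use r in simp)
  then have G0: "G 1 t z = 0" if "det (A t z) = 0 \<or> det (B t z) = 0" for t z
    using that detM by (metis mult_eq_0_iff power_eq_0_iff zero_neq_numeral)
  have line: False if "\<And>t. G 1 t (e + f * t) = 0" for e f
    using no_line[of e f] poly_all_0_iff_0[of "on_line e f"] that by (simp add: poly_on_line)
  have conic: False
    if factor: "\<And>t z. (e + t * f - z) * (g + t * h - z) - (k + t * k') * (n + t * n') = 0 \<Longrightarrow> G 1 t z = 0"
    for e f g h k k' n n'
  proof -
    have "G 1 t z = 0" if "(z - (e + f * t)) * (z - (g + h * t)) = (k + k' * t) * (n + n' * t)" for t z
      using that by (intro factor) (simp add: algebra_simps)
    from linear_factor_of_quadratic_factor[OF this] show False using no_line by blast
  qed
  have "r = 1 \<or> r = 2 \<or> 6 - r = 1 \<or> 6 - r = 2" using r \<open>r \<noteq> 3\<close> by linarith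
  then show False
  proof (elim disjE)
    assume r1: "r = 1"
    have "det (A t z) = H $$ (0, 0) + t * K $$ (0, 0) - z" for t z
      using det_single[of "A t z"] r1 by (simp add: A_def Mij)
    then show False using line[of "H $$ (0, 0)" "K $$ (0, 0)"] G0 by (simp add: mult.commute)
  next
    assume r1: "6 - r = 1"
    then have r5: "r = 5" by simp
    have "det (B t z) = H $$ (5, 5) + t * K $$ (5, 5) - z" for t z
      using det_single[of "B t z"] r5 by (simp add: B_def Mij)
    then show False using line[of "H $$ (5, 5)" "K $$ (5, 5)"] G0 by (simp add: mult.commute)
  next
    assume r2: "r = 2"
    have "A t z \<in> carrier_mat 2 2" for t z using r2 by (simp add: A_def)
    then have "det (A t z) = (H $$ (0, 0) + t * K $$ (0, 0) - z) * (H $$ (1, 1) + t * K $$ (1, 1) - z)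
      - (H $$ (0, 1) + t * K $$ (0, 1)) * (H $$ (1, 0) + t * K $$ (1, 0))" for t z
      using r2 by (simp add: det_2 A_def Mij)
    with G0 show False
      by (intro conic[of "H $$ (0, 0)" "K $$ (0, 0)" "H $$ (1, 1)" "K $$ (1, 1)"
        "H $$ (0, 1)" "K $$ (0, 1)" "H $$ (1, 0)" "K $$ (1, 0)"]) simp
  next
    assume r2: "6 - r = 2"
    then have r4: "r = 4" by simp
    have "B t z \<in> carrier_mat 2 2" for t z using r2 by (simp add: B_def)
    then have "det (B t z) = (H $$ (4, 4) + t * K $$ (4, 4) - z) * (H $$ (5, 5) + t * K $$ (5, 5) - z)
      - (H $$ (4, 5) + t * K $$ (4, 5)) * (H $$ (5, 4) + t * K $$ (5, 4))" for t z
      using r4 by (simp add: det_2 B_def Mij)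
    with G0 show False
      by (intro conic[of "H $$ (4, 4)" "K $$ (4, 4)" "H $$ (5, 5)" "K $$ (5, 5)"
        "H $$ (4, 5)" "K $$ (4, 5)" "H $$ (5, 4)" "K $$ (5, 4)"]) simp
  qed
qed

lemma unitary_block_diagonalization:
  "\<exists>U. U * adj U = 1 \<and> adj U * U = 1 \<and>
    (\<forall>i<6. \<forall>j<6. (i < 3) \<noteq> (j < 3) \<longrightarrow> ent (U * X * adj U) i j = 0 \<and> ent (U * Y * adj U) i j = 0)"
  using reducible invariant_block_size by metis

end

section \<open>Normalisation of \<open>F\<close> and the conclusion\<close>

lemma direct_sum_mat_of_blocks:
  assumes "A \<in> carrier_mat 6 6" "\<And>i j. i < 6 \<Longrightarrow> j < 6 \<Longrightarrow> (i < 3) \<noteq> (j < 3) \<Longrightarrow> A $$ (i, j) = 0"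
  shows "A = direct_sum_mat (mat 3 3 (\<lambda>(i, j). A $$ (i, j))) (mat 3 3 (\<lambda>(i, j). A $$ (i + 3, j + 3)))"
  using assms unfolding direct_sum_mat_def by (intro eq_matI) auto

theorem corollary5p3:
  fixes H K :: "complex mat" and F :: poly3
  assumes "H \<in> carrier_mat 6 6" and "hermitian_mat H"
    and "K \<in> carrier_mat 6 6" and "hermitian_mat K"
    and "smooth_plane_curve 3 F"
    and "\<And>x y z :: complex.
      det (x \<cdot>\<^sub>m H + y \<cdot>\<^sub>m K - z \<cdot>\<^sub>m 1\<^sub>m 6) = (eval3 F x y z)\<^sup>2"
  shows "\<exists>U\<in>carrier_mat 6 6. unitary_mat U \<and>
    (\<exists>H1\<in>carrier_mat 3 3. \<exists>H2\<in>carrier_mat 3 3.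
     \<exists>K1\<in>carrier_mat 3 3. \<exists>K2\<in>carrier_mat 3 3.
       U * H * mat_adjoint U = direct_sum_mat H1 H2 \<and>
       U * K * mat_adjoint U = direct_sum_mat K1 K2)"
proof -
  define X where "X = of_mat H"
  define Y where "Y = of_mat K"
  have XY: "to_mat X = H" "to_mat Y = K" using assms(1,3) by (simp_all add: X_def Y_def of_mat_inverse)
  have hom: "homogeneous3 3 F" using assms(5) by (simp add: smooth_plane_curve_def)
  define c where "c i j k = Poly_Mapping.lookup F (i, j, k)" for i j k
  define \<epsilon> where "\<epsilon> = c 0 0 3"
  note F = eval3_cubic[OF hom, folded c_def]
  \<comment> \<open>At \<open>(0, 0, 1)\<close> the determinant is that of the negative identity,
    which is 1 in even size; hence the coefficient of \<open>z ^ 3\<close> in \<open>F\<close> is a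
    sign, and \<open>F\<close> is this sign times a monic \<open>G\<close>.\<close>
  have "0 \<cdot>\<^sub>m H + 0 \<cdot>\<^sub>m K - 1 \<cdot>\<^sub>m 1\<^sub>m 6 = (- 1) \<cdot>\<^sub>m 1\<^sub>m 6" using assms(1,3) by (intro eq_matI) auto
  then have "\<epsilon>\<^sup>2 = 1" using assms(6)[of 0 0 1] by (simp add: F \<epsilon>_def)
  then have \<epsilon>: "\<epsilon> * \<epsilon> = 1" "\<epsilon> * (\<epsilon> * t) = t" for t by (simp_all add: power2_eq_square mult.assoc[symmetric])
  then have \<epsilon>0: "\<epsilon> \<noteq> 0" by auto
  interpret monic_ternary_cubic "\<epsilon> * c 1 0 2" "\<epsilon> * c 0 1 2" "\<epsilon> * c 2 0 1" "\<epsilon> * c 1 1 1" "\<epsilon> * c 0 2 1"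
    "\<epsilon> * c 3 0 0" "\<epsilon> * c 2 1 0" "\<epsilon> * c 1 2 0" "\<epsilon> * c 0 3 0" .
  have F_G: "eval3 F x y z = \<epsilon> * G x y z" "eval3 (partial_x F) x y z = \<epsilon> * Gx x y z"
    "eval3 (partial_y F) x y z = \<epsilon> * Gy x y z" "eval3 (partial_z F) x y z = \<epsilon> * Gz x y z" for x y z
    unfolding F G_def Gx_def Gy_def Gz_def by (simp_all add: algebra_simps \<epsilon> \<epsilon>_def[symmetric])
  interpret hermitian_double_cubic "\<epsilon> * c 1 0 2" "\<epsilon> * c 0 1 2" "\<epsilon> * c 2 0 1" "\<epsilon> * c 1 1 1" "\<epsilon> * c 0 2 1"
    "\<epsilon> * c 3 0 0" "\<epsilon> * c 2 1 0" "\<epsilon> * c 1 2 0" "\<epsilon> * c 0 3 0" X Y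
  proof
    show "adj X = X" "adj Y = Y"
      using assms(2,4) by (simp_all flip: to_mat_inject add: adj.rep_eq XY hermitian_mat_def)
    show "det (x \<cdot>\<^sub>m to_mat X + y \<cdot>\<^sub>m to_mat Y - z \<cdot>\<^sub>m 1\<^sub>m 6) = (G x y z)\<^sup>2" for x y z
      unfolding XY assms(6) F_G by (simp add: power_mult_distrib \<open>\<epsilon>\<^sup>2 = 1\<close>)
    show "Gx x y z \<noteq> 0 \<or> Gy x y z \<noteq> 0 \<or> Gz x y z \<noteq> 0" if "(x, y, z) \<noteq> (0, 0, 0)" "G x y z = 0" for x y z
      using assms(5) that unfolding smooth_plane_curve_def F_G by auto
  qed
  obtain U where U: "U * adj U = 1" "adj U * U = 1"
    and zero: "\<forall>i<6. \<forall>j<6. (i < 3) \<noteq> (j < 3) \<longrightarrow> ent (U * X * adj U) i j = 0 \<and> ent (U * Y * adj U) i j = 0"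
    using unitary_block_diagonalization by blast
  define V where "V = to_mat U"
  have V: "V \<in> carrier_mat 6 6" by (simp add: V_def)
  have "unitary_mat V"
    using arg_cong[OF U(1), of to_mat] arg_cong[OF U(2), of to_mat] carrier_matD[OF V]
    by (simp add: unitary_mat_def V_def times_mat6.rep_eq one_mat6.rep_eq adj.rep_eq)
  moreover have VX: "V * H * mat_adjoint V = to_mat (U * X * adj U)" "V * K * mat_adjoint V = to_mat (U * Y * adj U)"
    by (simp_all add: V_def times_mat6.rep_eq adj.rep_eq XY)
  have "\<exists>A1\<in>carrier_mat 3 3. \<exists>A2\<in>carrier_mat 3 3. to_mat A = direct_sum_mat A1 A2"
    if "\<forall>i<6. \<forall>j<6. (i < 3) \<noteq> (j < 3) \<longrightarrow> ent A i j = 0" for A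
    using direct_sum_mat_of_blocks[of "to_mat A"] that by (metis mat_carrier ent.rep_eq to_mat_carrier)
  then have "\<exists>A1\<in>carrier_mat 3 3. \<exists>A2\<in>carrier_mat 3 3. V * H * mat_adjoint V = direct_sum_mat A1 A2"
    "\<exists>A1\<in>carrier_mat 3 3. \<exists>A2\<in>carrier_mat 3 3. V * K * mat_adjoint V = direct_sum_mat A1 A2"
    unfolding VX using zero by blast+
  ultimately show ?thesis using V by blast
qed

end
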